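(* Let $\Omega\subset\mathbb{R}^d$ ($d=2,3$) be a bounded regular domain, $\nu>0$, and let $\|\cdot\|$ and $(\cdot,\cdot)$ denote the $L^2(\Omega)$ norm and inner product. Let time-steps $k_n>0$ and artificial compression parameters $\varepsilon_n>0$ be arbitrary positive numbers, let forcing terms $f_{n}\in H^{-1}(\Omega)^d$ be given, and let initial data $u_0$ (and, for the extrapolation at the first step, $u_{-1}$), $p_0$ be given. Suppose $u_{n}\in H^1_0(\Omega)^d$ (so $u_n=0$ on $\partial\Omega$) and $p_n\in L^2(\Omega)$, $n\ge 1$, satisfy the min-Method: for each $n\ge 0$, with $u^{\ast}=\left(1+\frac{k_{n+1}}{k_n}\right)u_n-\frac{k_{n+1}}{k_n}u_{n-1}$, $$\frac{u_{n+1}-u_{n}}{k_{n+1}}+u^{\ast}\cdot\nabla u_{n+1}+\tfrac{1}{2}(\nabla\cdot u^{\ast})u_{n+1}+\nabla p_{n+1}-\nu\Delta u_{n+1}=f_{n+1},$$ $$\frac{\varepsilon_{n+1}p_{n+1}-\min\{\varepsilon_{n+1},\varepsilon_n\}p_{n}}{k_{n+1}}+\nabla\cdot u_{n+1}=0,$$ the equations being understood in the standard variational (weak) sense. Then the method is unconditionally, long-time stable: for any $N>0$ the energy equality \begin{gather*} \frac{1}{2}\int_{\Omega}|u_{N}|^{2}+\varepsilon_{N}|p_{N}|^{2}\,dx+\sum_{n=0}^{N-1}\frac{1}{2}\int_{\Omega}\Big[\min\{\varepsilon_{n+1},\varepsilon_{n}\}(p_{n+1}-p_{n})^{2}+(\varepsilon_{n+1}-\varepsilon_{n})^{+}p_{n+1}^{2}+(\varepsilon_{n}-\varepsilon_{n+1})^{+}p_{n}^{2}\Big]dx\\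 +\sum_{n=0}^{N-1}\int_{\Omega}\frac{1}{2}|u_{n+1}-u_{n}|^{2}+k_{n+1}\nu|\nabla u_{n+1}|^{2}\,dx =\frac{1}{2}\int_{\Omega}|u_{0}|^{2}+\varepsilon_{0}p_{0}^{2}\,dx+\sum_{n=0}^{N-1}k_{n+1}\int_{\Omega}u_{n+1}\cdot f_{n+1}\,dx \end{gather*} holds, and consequently the stability bound \begin{gather*} \frac{1}{2}\int_{\Omega}|u_{N}|^{2}+\varepsilon_{N}p_{N}^{2}\,dx+\sum_{n=0}^{N-1}\frac{1}{2}\int_{\Omega}\Big[\min\{\varepsilon_{n+1},\varepsilon_{n}\}(p_{n+1}-p_{n})^{2}+(\varepsilon_{n+1}-\varepsilon_{n})^{+}p_{n+1}^{2}+(\varepsilon_{n}-\varepsilon_{n+1})^{+}p_{n}^{2}\Big]dx\\ +\sum_{n=0}^{N-1}\frac{1}{2}\int_{\Omega}|u_{n+1}-u_{n}|^{2}+k_{n+1}\nu|\nabla u_{n+1}|^{2}\,dx \le\frac{1}{2}\int_{\Omega}|u_{0}|^{2}+\varepsilon_{0}p_{0}^{2}\,dx+\sum_{n=0}^{N-1}k_{n+1}\frac{1}{2\nu}\|f_{n+1}\|_{-1}^{2} \end{gather*} holds.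
   Context: For a real number $a$, $a^{+}=\max\{0,a\}$. $\|\cdot\|_{-1}$ denotes the norm of the dual space $H^{-1}(\Omega)$ of $H^1_0(\Omega)$ (equipped with the norm $\|\nabla\cdot\|$). The nonlinear term is in the skew-symmetrized form $u^{\ast}\cdot\nabla u_{n+1}+\frac12(\nabla\cdot u^{\ast})u_{n+1}$. No restriction is placed on the sequences $k_n$, $\varepsilon_n$ other than positivity. *)

theory Defs
  imports "HOL-Analysis.Analysis"
begin

definition lipschitz_domain :: "'a::euclidean_space set \<Rightarrow> bool" where
  "lipschitz_domain \<Omega> \<longleftrightarrow> open \<Omega> \<and> connected \<Omega> \<and> \<Omega> \<noteq> {} \<and> bounded \<Omega> \<and>
     (\<forall>x0\<in>frontier \<Omega>. \<exists>r>0. \<exists>e::'a. \<exists>g::'a \<Rightarrow> real. \<exists>L.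
        norm e = 1 \<and> L-lipschitz_on {y. y \<bullet> e = 0} g \<and>
        \<Omega> \<inter> ball x0 r = {y \<in> ball x0 r. y \<bullet> e < g (y - (y \<bullet> e) *\<^sub>R e)})"

fun Ck :: "nat \<Rightarrow> ('a::euclidean_space \<Rightarrow> real) \<Rightarrow> bool" where
  "Ck 0 f = continuous_on UNIV f"
| "Ck (Suc m) f = (f differentiable_on UNIV \<and>
      (\<forall>i\<in>Basis. Ck m (\<lambda>x. frechet_derivative f (at x) i)))"

definition smooth_fun :: "('a::euclidean_space \<Rightarrow> real) \<Rightarrow> bool" where
  "smooth_fun f \<longleftrightarrow> (\<forall>m. Ck m f)"

definition test_fun :: "'a::euclidean_space set \<Rightarrow> ('a \<Rightarrow> real) \<Rightarrow> bool" where
  "test_fun \<Omega> \<phi> \<longleftrightarrow> smooth_fun \<phi> \<and> compact (closure {x. \<phi> x \<noteq> 0}) \<and>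
     closure {x. \<phi> x \<noteq> 0} \<subseteq> \<Omega>"

definition test_vfun :: "'a::euclidean_space set \<Rightarrow> ('a \<Rightarrow> 'a) \<Rightarrow> bool" where
  "test_vfun \<Omega> \<phi> \<longleftrightarrow> (\<forall>j\<in>Basis. test_fun \<Omega> (\<lambda>x. \<phi> x \<bullet> j))"

definition L2 :: "'a::euclidean_space set \<Rightarrow> ('a \<Rightarrow> real) \<Rightarrow> bool" where
  "L2 \<Omega> f \<longleftrightarrow> f \<in> borel_measurable (lebesgue_on \<Omega>) \<and>
     integrable (lebesgue_on \<Omega>) (\<lambda>x. (f x)\<^sup>2)"

definition L2v :: "'a::euclidean_space set \<Rightarrow> ('a \<Rightarrow> 'a) \<Rightarrow> bool" where
  "L2v \<Omega> u \<longleftrightarrow> u \<in> borel_measurable (lebesgue_on \<Omega>) \<and>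
     integrable (lebesgue_on \<Omega>) (\<lambda>x. (norm (u x))\<^sup>2)"

text \<open>A gradient field Du of a vector field u is represented by Du x i = \<partial>_i u (x)
  for basis vectors i.  Du is a weak gradient of u on \<Omega> if for every component j
  and direction i, and every test function \<phi>,
  \<integral>_\<Omega> u_j \<partial>_i\<phi> = - \<integral>_\<Omega> (\<partial>_i u)_j \<phi>.\<close>
definition weak_grad :: "'a::euclidean_space set \<Rightarrow> ('a \<Rightarrow> 'a) \<Rightarrow> ('a \<Rightarrow> 'a \<Rightarrow> 'a) \<Rightarrow> bool" where
  "weak_grad \<Omega> u Du \<longleftrightarrow> (\<forall>i\<in>Basis. \<forall>j\<in>Basis. \<forall>\<phi>. test_fun \<Omega> \<phi> \<longrightarrow>
      (LINT x|lebesgue_on \<Omega>. (u x \<bullet> j) * frechet_derivative \<phi> (at x) i)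
      = - (LINT x|lebesgue_on \<Omega>. (Du x i \<bullet> j) * \<phi> x))"

definition H1 :: "'a::euclidean_space set \<Rightarrow> ('a \<Rightarrow> 'a) \<Rightarrow> ('a \<Rightarrow> 'a \<Rightarrow> 'a) \<Rightarrow> bool" where
  "H1 \<Omega> u Du \<longleftrightarrow> L2v \<Omega> u \<and> (\<forall>i\<in>Basis. L2v \<Omega> (\<lambda>x. Du x i)) \<and> weak_grad \<Omega> u Du"

definition H10 :: "'a::euclidean_space set \<Rightarrow> ('a \<Rightarrow> 'a) \<Rightarrow> ('a \<Rightarrow> 'a \<Rightarrow> 'a) \<Rightarrow> bool" where
  "H10 \<Omega> u Du \<longleftrightarrow> H1 \<Omega> u Du \<and>
     (\<exists>\<phi>::nat \<Rightarrow> 'a \<Rightarrow> 'a. (\<forall>m. test_vfun \<Omega> (\<phi> m)) \<and>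
        (\<lambda>m. LINT x|lebesgue_on \<Omega>. (norm (\<phi> m x - u x))\<^sup>2) \<longlonglongrightarrow> 0 \<and>
        (\<lambda>m. LINT x|lebesgue_on \<Omega>.
            (\<Sum>i\<in>Basis. (norm (frechet_derivative (\<phi> m) (at x) i - Du x i))\<^sup>2)) \<longlonglongrightarrow> 0)"

definition grad_sq :: "('a::euclidean_space \<Rightarrow> 'a \<Rightarrow> 'a) \<Rightarrow> 'a \<Rightarrow> real" where
  "grad_sq Du x = (\<Sum>i\<in>Basis. (norm (Du x i))\<^sup>2)"

definition grad_inner :: "('a::euclidean_space \<Rightarrow> 'a \<Rightarrow> 'a) \<Rightarrow> ('a \<Rightarrow> 'a \<Rightarrow> 'a) \<Rightarrow> 'a \<Rightarrow> real" where
  "grad_inner Du Dv x = (\<Sum>i\<in>Basis. Du x i \<bullet> Dv x i)"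

definition divg :: "('a::euclidean_space \<Rightarrow> 'a \<Rightarrow> 'a) \<Rightarrow> 'a \<Rightarrow> real" where
  "divg Du x = (\<Sum>i\<in>Basis. Du x i \<bullet> i)"

definition convect :: "('a::euclidean_space \<Rightarrow> 'a) \<Rightarrow> ('a \<Rightarrow> 'a \<Rightarrow> 'a) \<Rightarrow> 'a \<Rightarrow> 'a" where
  "convect w Du x = (\<Sum>i\<in>Basis. (w x \<bullet> i) *\<^sub>R Du x i)"

definition grad_norm :: "'a::euclidean_space set \<Rightarrow> ('a \<Rightarrow> 'a \<Rightarrow> 'a) \<Rightarrow> real" where
  "grad_norm \<Omega> Dv = sqrt (LINT x|lebesgue_on \<Omega>. grad_sq Dv x)"

text \<open>An element of H^{-1}(\<Omega>)^d is represented by the functional v \<mapsto> <f, v> on H^1_0(\<Omega>)^d: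
  linear and bounded w.r.t. \<parallel>\<nabla>\<cdot>\<parallel>.\<close>
definition Hm1 :: "'a::euclidean_space set \<Rightarrow> (('a \<Rightarrow> 'a) \<Rightarrow> real) \<Rightarrow> bool" where
  "Hm1 \<Omega> F \<longleftrightarrow>
     (\<forall>v Dv w Dw (a::real) (b::real). H10 \<Omega> v Dv \<longrightarrow> H10 \<Omega> w Dw \<longrightarrow>
        F (\<lambda>x. a *\<^sub>R v x + b *\<^sub>R w x) = a * F v + b * F w) \<and>
     (\<exists>C. \<forall>v Dv. H10 \<Omega> v Dv \<longrightarrow> \<bar>F v\<bar> \<le> C * grad_norm \<Omega> Dv)"

text \<open>Dual norm \<parallel>f\<parallel>_{-1} = sup over v \<in> H^1_0, v \<noteq> 0, of |<f,v>| / \<parallel>\<nabla>v\<parallel>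
  (for \<parallel>\<nabla>v\<parallel> = 0 the quotient is 0 by the HOL convention x/0 = 0, which does not change the sup).\<close>
definition dual_norm :: "'a::euclidean_space set \<Rightarrow> (('a \<Rightarrow> 'a) \<Rightarrow> real) \<Rightarrow> real" where
  "dual_norm \<Omega> F = Sup {\<bar>F v\<bar> / grad_norm \<Omega> Dv | v Dv. H10 \<Omega> v Dv}"

definition prev :: "'b \<Rightarrow> (nat \<Rightarrow> 'b) \<Rightarrow> nat \<Rightarrow> 'b" where
  "prev um1 u n = (if n = 0 then um1 else u (n - 1))"

definition pos_part :: "real \<Rightarrow> real" where
  "pos_part a = max 0 a"

end

theory Submission
  imports Defs
begin

text \<open>
  Formally the energy equality comes from testing the momentum equation with \<open>u\<^sub>n\<^sub>+\<^sub>1\<close> itself, but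
  for \<open>u\<^sup>*\<close> merely in \<open>H\<^sup>1\<close> the convection term is then integrable only thanks to an embedding
  of \<open>H\<^sup>1(\<Omega>)\<close> into \<open>L\<^sup>4(\<Omega>)\<close>.  This embedding is avoided by testing with the bounded fields whose
  components are \<open>T\<^sub>\<delta>(u\<^sub>j) = sin(\<delta> u\<^sub>j)/\<delta>\<close>.  With the primitive
  \<open>S\<^sub>\<delta>(s) = (1 - cos(\<delta> s))/\<delta>\<^sup>2\<close> of \<open>T\<^sub>\<delta>\<close>, integration by parts turns
  \<open>\<integral> u\<^sup>* \<cdot> \<nabla>u\<^sub>j T\<^sub>\<delta>(u\<^sub>j)\<close> into \<open>- \<integral> (\<nabla> \<cdot> u\<^sup>*) S\<^sub>\<delta>(u\<^sub>j)\<close>, so that the skew-symmetrized term equals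
  \<open>\<Sum>\<^sub>j \<integral> (\<nabla> \<cdot> u\<^sup>*) (u\<^sub>j T\<^sub>\<delta>(u\<^sub>j)/2 - S\<^sub>\<delta>(u\<^sub>j))\<close>.  The integrand is dominated by
  \<open>|\<nabla> \<cdot> u\<^sup>*| u\<^sub>j\<^sup>2\<close>, which is integrable because \<open>H\<^sup>1\<^sub>0\<close> embeds into \<open>L\<^sup>4\<close> in dimensions 2 and 3
  (Ladyzhenskaya's inequality), and it tends to 0 with \<open>\<delta>\<close>.  The functional on the right-hand side
  passes to the limit since it is bounded in the gradient norm.  What remains is the polarization
  identity for the velocity, the corresponding identity with weights for the pressure, and
  a telescoping sum; the stability bound follows by Young's inequality.
\<close>

section \<open>Smooth functions and test functions\<close>

abbreviation partial ::
  "'a \<Rightarrow> ('a::euclidean_space \<Rightarrow> 'b::real_normed_vector) \<Rightarrow> 'a \<Rightarrow> 'b" where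
  "partial i f \<equiv> \<lambda>x. frechet_derivative f (at x) i"

lemma Ck_Suc_has_derivative:
  "Ck (Suc m) f \<Longrightarrow> (f has_derivative frechet_derivative f (at x)) (at x)"
  using frechet_derivative_works by (auto simp: differentiable_on_def)

lemma Ck_Suc_partial: "Ck (Suc m) f \<Longrightarrow> i \<in> Basis \<Longrightarrow> Ck m (partial i f)"
  by simp

lemma Ck_SucD: "Ck (Suc m) f \<Longrightarrow> Ck m f"
proof (induction m arbitrary: f)
  case 0
  then show ?case by (auto intro: differentiable_imp_continuous_on)
next
  case (Suc m)
  have "Ck m (partial i f)" if "i \<in> Basis" for i
    using Suc.IH[OF Ck_Suc_partial[OF Suc.prems that]] .
  moreover have "f differentiable_on UNIV" using Suc.prems by simp
  ultimately show ?case by simp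
qed

lemma Ck_SucI:
  assumes "\<And>x. (f has_derivative f' x) (at x)" and "\<And>i. i \<in> Basis \<Longrightarrow> Ck m (\<lambda>x. f' x i)"
  shows "Ck (Suc m) f"
proof -
  have "frechet_derivative f (at x) = f' x" for x
    using frechet_derivative_at[OF assms(1)] by simp
  with assms show ?thesis
    by (auto simp: differentiable_on_def differentiable_def)
qed

declare Ck.simps(2) [simp del]

lemma Ck_const: "Ck m (\<lambda>x. c)"
proof (induction m arbitrary: c)
  case (Suc m)
  show ?case by (rule Ck_SucI[where f' = "\<lambda>_ _. 0"]) (auto intro: Suc)
qed simp

lemma Ck_add: "Ck m f \<Longrightarrow> Ck m g \<Longrightarrow> Ck m (\<lambda>x. f x + g x)"
proof (induction m arbitrary: f g)
  case (Suc m)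
  note f = Suc.prems(1) and g = Suc.prems(2)
  show ?case
    by (rule Ck_SucI[OF has_derivative_add[OF Ck_Suc_has_derivative[OF f] Ck_Suc_has_derivative[OF g]]])
       (intro Suc.IH Ck_Suc_partial f g)
qed (auto intro: continuous_intros)

lemma Ck_mult: "Ck m f \<Longrightarrow> Ck m g \<Longrightarrow> Ck m (\<lambda>x. f x * g x)"
proof (induction m arbitrary: f g)
  case (Suc m)
  note f = Suc.prems(1) and g = Suc.prems(2)
  show ?case
    by (rule Ck_SucI[OF has_derivative_mult[OF Ck_Suc_has_derivative[OF f] Ck_Suc_has_derivative[OF g]]])
       (intro Ck_add Suc.IH Ck_Suc_partial f g Ck_SucD[OF f] Ck_SucD[OF g])
qed (auto intro: continuous_intros)

lemma has_derivative_compose_real: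
  assumes "(f has_derivative f') (at x)" and "(G has_real_derivative G') (at (f x))"
  shows "((\<lambda>x. G (f x)) has_derivative (\<lambda>h. G' * f' h)) (at x)"
  using has_derivative_compose[OF assms(1) has_field_derivative_imp_has_derivative[OF assms(2)]] .

lemma Ck_compose:
  fixes G :: "real \<Rightarrow> real"
  shows "Ck m G \<Longrightarrow> Ck m f \<Longrightarrow> Ck m (\<lambda>x. G (f x))"
proof (induction m arbitrary: G f)
  case 0
  then show ?case
    using continuous_on_compose2[of UNIV G UNIV f] by auto
next
  case (Suc m)
  note G = Suc.prems(1) and f = Suc.prems(2)
  have "(G has_real_derivative partial 1 G y) (at y)" for y
  proof -
    note G' = Ck_Suc_has_derivative[OF G, of y]
    have linear: "frechet_derivative G (at y) = (\<lambda>h. partial 1 G y * h)"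
    proof
      show "frechet_derivative G (at y) h = partial 1 G y * h" for h
        using linear_scale[OF has_derivative_linear[OF G'], of h 1] by (simp add: mult.commute)
    qed
    show ?thesis
      using G' unfolding has_field_derivative_def by (subst (asm) linear)
  qed
  note chain = has_derivative_compose_real[OF Ck_Suc_has_derivative[OF f] this]
  show ?case
    by (rule Ck_SucI[OF chain], rule Ck_mult[OF Suc.IH[OF Ck_Suc_partial[OF G] Ck_SucD[OF f]]
          Ck_Suc_partial[OF f]]) simp_all
qed

lemma smooth_fun_has_derivative:
  "smooth_fun f \<Longrightarrow> (f has_derivative frechet_derivative f (at x)) (at x)"
  unfolding smooth_fun_def using Ck_Suc_has_derivative by blast

lemma smooth_fun_partial: "smooth_fun f \<Longrightarrow> i \<in> Basis \<Longrightarrow> smooth_fun (partial i f)"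
  unfolding smooth_fun_def using Ck_Suc_partial by blast

lemma smooth_fun_continuous: "smooth_fun f \<Longrightarrow> continuous_on UNIV f"
  unfolding smooth_fun_def using Ck.simps(1) by blast

lemma smooth_fun_mult: "smooth_fun f \<Longrightarrow> smooth_fun g \<Longrightarrow> smooth_fun (\<lambda>x. f x * g x)"
  by (simp add: smooth_fun_def Ck_mult)

lemma smooth_fun_lincomb:
  "smooth_fun f \<Longrightarrow> smooth_fun g \<Longrightarrow> smooth_fun (\<lambda>x. a * f x + b * g x)"
  by (simp add: smooth_fun_def Ck_add Ck_mult Ck_const)

lemma smooth_fun_compose:
  fixes G :: "real \<Rightarrow> real"
  shows "smooth_fun G \<Longrightarrow> smooth_fun f \<Longrightarrow> smooth_fun (\<lambda>x. G (f x))"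
  by (simp add: smooth_fun_def Ck_compose)

lemma smooth_fun_trig: "smooth_fun (\<lambda>s::real. a * sin (\<omega> * s) + b * cos (\<omega> * s) + c)"
  unfolding smooth_fun_def
proof
  show "Ck m (\<lambda>s::real. a * sin (\<omega> * s) + b * cos (\<omega> * s) + c)" for m
  proof (induction m arbitrary: a b c)
    case 0
    show ?case by (auto intro!: continuous_intros)
  next
    case (Suc m)
    have "((\<lambda>s. a * sin (\<omega> * s) + b * cos (\<omega> * s) + c) has_derivative
        (\<lambda>h. h * (- \<omega> * b * sin (\<omega> * s) + \<omega> * a * cos (\<omega> * s) + 0))) (at s)" for s :: real
      by (auto intro!: derivative_eq_intros simp: algebra_simps)
    then show ?case by (rule Ck_SucI) (use Suc[of "- \<omega> * b" "\<omega> * a" 0] in simp)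
  qed
qed

lemma test_fun_iff:
  "test_fun \<Omega> f \<longleftrightarrow> smooth_fun f \<and> (\<exists>K. compact K \<and> K \<subseteq> \<Omega> \<and> (\<forall>x. x \<notin> K \<longrightarrow> f x = 0))"
proof
  assume "test_fun \<Omega> f"
  then show "smooth_fun f \<and> (\<exists>K. compact K \<and> K \<subseteq> \<Omega> \<and> (\<forall>x. x \<notin> K \<longrightarrow> f x = 0))"
    unfolding test_fun_def using closure_subset[of "{x. f x \<noteq> 0}"] by blast
next
  assume "smooth_fun f \<and> (\<exists>K. compact K \<and> K \<subseteq> \<Omega> \<and> (\<forall>x. x \<notin> K \<longrightarrow> f x = 0))"
  then obtain K where f: "smooth_fun f" and K: "compact K" "K \<subseteq> \<Omega>" "{x. f x \<noteq> 0} \<subseteq> K"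
    by auto
  have "closure {x. f x \<noteq> 0} \<subseteq> K"
    using K by (intro closure_minimal compact_imp_closed)
  moreover from this have "closure {x. f x \<noteq> 0} = K \<inter> closure {x. f x \<noteq> 0}"
    by blast
  then have "compact (closure {x. f x \<noteq> 0})"
    using compact_Int_closed[OF K(1) closed_closure] by metis
  ultimately show "test_fun \<Omega> f"
    using f K(2) by (auto simp: test_fun_def)
qed

lemma test_fun_smooth: "test_fun \<Omega> f \<Longrightarrow> smooth_fun f"
  by (simp add: test_fun_def)

lemma test_fun_has_derivative:
  "test_fun \<Omega> f \<Longrightarrow> (f has_derivative frechet_derivative f (at x)) (at x)"
  by (intro smooth_fun_has_derivative test_fun_smooth)

lemma test_fun_continuous: "test_fun \<Omega> f \<Longrightarrow> continuous_on UNIV f"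
  by (intro smooth_fun_continuous test_fun_smooth)

lemma test_fun_measurable [measurable]: "test_fun \<Omega> f \<Longrightarrow> f \<in> borel_measurable borel"
  by (intro borel_measurable_continuous_onI test_fun_continuous)

lemma test_fun_zero_outside: "test_fun \<Omega> f \<Longrightarrow> x \<notin> \<Omega> \<Longrightarrow> f x = 0"
  unfolding test_fun_iff by blast

lemma test_fun_compose:
  assumes "smooth_fun G" "G (0::real) = 0" "test_fun \<Omega> f"
  shows "test_fun \<Omega> (\<lambda>x. G (f x))"
  using assms smooth_fun_compose[OF assms(1), of f] unfolding test_fun_iff by metis

lemma test_fun_mult:
  assumes "test_fun \<Omega> f" "test_fun \<Omega> g"
  shows "test_fun \<Omega> (\<lambda>x. f x * g x)"
  using assms smooth_fun_mult[of f g] unfolding test_fun_iff by (metis mult_zero_left)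

lemma test_fun_lincomb:
  assumes "test_fun \<Omega> f" "test_fun \<Omega> g"
  shows "test_fun \<Omega> (\<lambda>x. a * f x + b * g x)"
proof -
  obtain K L where "compact K" "K \<subseteq> \<Omega>" "\<And>x. x \<notin> K \<Longrightarrow> f x = 0"
    and "compact L" "L \<subseteq> \<Omega>" "\<And>x. x \<notin> L \<Longrightarrow> g x = 0"
    using assms unfolding test_fun_iff by blast
  then have "compact (K \<union> L)" "K \<union> L \<subseteq> \<Omega>" "\<And>x. x \<notin> K \<union> L \<Longrightarrow> a * f x + b * g x = 0"
    by auto
  then show ?thesis
    unfolding test_fun_iff using smooth_fun_lincomb[of f g a b] assms[THEN test_fun_smooth] by blast
qed

lemma test_fun_partial:
  assumes f: "test_fun \<Omega> f" and i: "i \<in> Basis"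
  shows "test_fun \<Omega> (partial i f)"
proof -
  obtain K where K: "compact K" "K \<subseteq> \<Omega>" "\<And>x. x \<notin> K \<Longrightarrow> f x = 0"
    using f unfolding test_fun_iff by blast
  have "partial i f x = 0" if "x \<notin> K" for x
  proof -
    have "(f has_derivative (\<lambda>_. 0)) (at x)"
      by (rule has_derivative_transform_within_open[of "\<lambda>_. 0" _ _ _ "- K"])
         (use K that in \<open>auto simp: compact_imp_closed open_Compl\<close>)
    then show ?thesis by (simp flip: frechet_derivative_at)
  qed
  then show ?thesis
    unfolding test_fun_iff using K smooth_fun_partial[OF test_fun_smooth[OF f] i] by blast
qed

lemma test_fun_bounded:
  assumes f: "test_fun \<Omega> f"
  obtains B where "\<And>x. \<bar>f x\<bar> \<le> B"
proof -
  obtain K where K: "compact K" "\<And>x. x \<notin> K \<Longrightarrow> f x = 0"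
    using f unfolding test_fun_iff by blast
  have "bounded (f ` K)"
    using K(1) test_fun_continuous[OF f]
    by (intro compact_imp_bounded compact_continuous_image) (auto intro: continuous_on_subset)
  then obtain B where "\<And>x. x \<in> K \<Longrightarrow> \<bar>f x\<bar> \<le> B"
    by (auto simp: bounded_iff)
  with K(2) have "\<bar>f x\<bar> \<le> max B 0" for x
    by (cases "x \<in> K") (auto simp: le_max_iff_disj)
  then show ?thesis using that by blast
qed

lemma test_fun_zero_outside_ball:
  assumes "test_fun \<Omega> f"
  obtains r where "r > 0" "\<And>x. norm x > r \<Longrightarrow> f x = 0"
proof -
  obtain K where K: "compact K" "\<And>x. x \<notin> K \<Longrightarrow> f x = 0"
    using assms unfolding test_fun_iff by blast
  then obtain r where "r > 0" "\<And>x. x \<in> K \<Longrightarrow> norm x \<le> r"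
    using compact_imp_bounded bounded_pos by metis
  with K(2) show ?thesis using that by (meson linorder_not_le)
qed

lemma test_fun_integrable_lborel:
  assumes "test_fun \<Omega> f"
  shows "integrable lborel f"
proof -
  obtain K where K: "compact K" "\<And>x. x \<notin> K \<Longrightarrow> f x = 0"
    using assms unfolding test_fun_iff by blast
  have "integrable lborel (\<lambda>x. indicator K x *\<^sub>R f x)"
    using K(1) test_fun_continuous[OF assms]
    by (intro borel_integrable_compact) (auto intro: continuous_on_subset)
  moreover have "(\<lambda>x. indicator K x *\<^sub>R f x) = f"
    using K(2) by (auto simp: indicator_def fun_eq_iff)
  ultimately show ?thesis by simp
qed

lemma test_fun_line_derivative:
  assumes "test_fun \<Omega> f"
  shows "((\<lambda>s. f (x + s *\<^sub>R i)) has_real_derivative partial i f (x + s *\<^sub>R i)) (at s)"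
proof -
  note f = test_fun_has_derivative[OF assms]
  have "((\<lambda>s. f (x + s *\<^sub>R i)) has_derivative (\<lambda>h. frechet_derivative f (at (x + s *\<^sub>R i)) (h *\<^sub>R i))) (at s)"
    by (rule has_derivative_compose[OF _ f]) (auto intro!: derivative_eq_intros)
  moreover have "frechet_derivative f (at (x + s *\<^sub>R i)) (h *\<^sub>R i) = partial i f (x + s *\<^sub>R i) * h" for h
    using linear_scale[OF has_derivative_linear[OF f]] by simp
  ultimately show ?thesis by (simp add: has_field_derivative_def)
qed

lemma borel_measurable_lebesgue_on:
  "f \<in> borel_measurable borel \<Longrightarrow> f \<in> borel_measurable (lebesgue_on \<Omega>)"
  by (intro measurable_restrict_space1 measurable_completion) simp

lemma
  fixes f :: "'a::euclidean_space \<Rightarrow> real"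
  assumes \<Omega>: "\<Omega> \<in> sets lebesgue" and f: "f \<in> borel_measurable borel"
    and zero: "\<And>x. x \<notin> \<Omega> \<Longrightarrow> f x = 0"
  shows integrable_lebesgue_on_eq_lborel: "integrable (lebesgue_on \<Omega>) f \<longleftrightarrow> integrable lborel f"
    and integral_lebesgue_on_eq_lborel: "(LINT x|lebesgue_on \<Omega>. f x) = (LINT x|lborel. f x)"
proof -
  have "(\<lambda>x. if x \<in> \<Omega> then f x else 0) = f"
    using zero by auto
  then show "integrable (lebesgue_on \<Omega>) f \<longleftrightarrow> integrable lborel f"
    and "(LINT x|lebesgue_on \<Omega>. f x) = (LINT x|lborel. f x)"
    using Lebesgue_Measure.integrable_restrict_UNIV[OF \<Omega>, of f]
      Lebesgue_Measure.integral_restrict_UNIV[OF \<Omega>, of f] f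
    by (simp_all add: integrable_completion integral_completion)
qed

lemma lborel_translate:
  fixes f :: "'a::euclidean_space \<Rightarrow> real"
  assumes f: "integrable lborel f"
  shows "integrable lborel (\<lambda>x. f (x + c))"
    and "(LINT x|lborel. f (x + c)) = (LINT x|lborel. f x)"
proof -
  have "integrable (distr lborel borel ((+) c)) f"
    using f by (simp add: lborel_distr_plus)
  then show "integrable lborel (\<lambda>x. f (x + c))"
    using f by (subst (asm) integrable_distr_eq) (auto simp: add.commute)
  have "(LINT x|distr lborel borel ((+) c). f x) = (LINT x|lborel. f (x + c))"
    using f by (subst integral_distr) (auto simp: add.commute)
  then show "(LINT x|lborel. f (x + c)) = (LINT x|lborel. f x)"
    by (simp add: lborel_distr_plus)
qed

lemma test_fun_difference_quotient_le:
  assumes f: "test_fun \<Omega> f" and h: "h > 0" and B: "\<And>x. \<bar>partial i f x\<bar> \<le> B"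
  shows "\<bar>(f (x + h *\<^sub>R i) - f x) / h\<bar> \<le> B"
proof -
  obtain z where "f (x + h *\<^sub>R i) - f (x + 0 *\<^sub>R i) = (h - 0) * partial i f (x + z *\<^sub>R i)"
    using MVT2[OF h test_fun_line_derivative[OF f, of x i]] by blast
  then show ?thesis using h B by simp
qed

lemma filterlim_inverse_Suc: "filterlim (\<lambda>n. 1 / real (Suc n)) (at 0) sequentially"
  unfolding filterlim_at using LIMSEQ_inverse_real_of_nat by (auto simp: inverse_eq_divide)

lemma integral_test_fun_partial:
  assumes f: "test_fun \<Omega> f" and i: "i \<in> Basis"
  shows "(LINT x|lborel. partial i f x) = 0"
proof -
  define q where "q h x = (f (x + h *\<^sub>R i) - f x) / h" for h x
  note [measurable] = test_fun_measurable[OF f] test_fun_measurable[OF test_fun_partial[OF f i]]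
  obtain r where r: "r > 0" "\<And>x. norm x > r \<Longrightarrow> f x = 0"
    using test_fun_zero_outside_ball[OF f] by blast
  obtain B where B: "\<And>x. \<bar>partial i f x\<bar> \<le> B"
    using test_fun_bounded[OF test_fun_partial[OF f i]] by blast
  have "(LINT x|lborel. q h x) = 0" for h
    unfolding q_def using test_fun_integrable_lborel[OF f]
    by (simp add: lborel_translate)
  moreover have "(\<lambda>n. LINT x|lborel. q (1 / real (Suc n)) x) \<longlonglongrightarrow> (LINT x|lborel. partial i f x)"
  proof (rule integral_dominated_convergence)
    show "integrable lborel (\<lambda>x. B * indicator (cball 0 (r + 1)) x)"
      using emeasure_lborel_cball_finite[of 0 "r + 1"]
      by (intro integrable_mult_right integrable_real_indicator) auto
    have "((\<lambda>h. q h x) \<longlongrightarrow> partial i f x) (at 0)" for x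
      using test_fun_line_derivative[OF f, of x i 0] by (simp add: DERIV_def q_def)
    then show "AE x in lborel. (\<lambda>n. q (1 / real (Suc n)) x) \<longlonglongrightarrow> partial i f x"
      by (intro always_eventually allI filterlim_compose[OF _ filterlim_inverse_Suc])
    have "\<bar>q h x\<bar> \<le> B * indicator (cball 0 (r + 1)) x" if h: "0 < h" "h \<le> 1" for h x
    proof (cases "norm x \<le> r + 1")
      case True
      then show ?thesis
        using test_fun_difference_quotient_le[OF f h(1) B] by (simp add: q_def)
    next
      case False
      have "norm (x + h *\<^sub>R i) \<ge> norm x - norm (h *\<^sub>R i)" by (rule norm_diff_ineq)
      then have "norm (x + h *\<^sub>R i) > r" using False h i by simp
      then show ?thesis using False r by (simp add: q_def)
    qed
    then show "AE x in lborel. norm (q (1 / real (Suc n)) x) \<le> B * indicator (cball 0 (r + 1)) x" for n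
      by simp
  qed (simp_all add: q_def)
  ultimately show ?thesis by (simp add: LIMSEQ_const_iff)
qed

section \<open>Square integrable functions and fields\<close>

lemma L2_measurable: "L2 \<Omega> f \<Longrightarrow> f \<in> borel_measurable (lebesgue_on \<Omega>)"
  by (simp add: L2_def)

lemma L2_square_integrable: "L2 \<Omega> f \<Longrightarrow> integrable (lebesgue_on \<Omega>) (\<lambda>x. (f x)\<^sup>2)"
  by (simp add: L2_def)

lemma L2_mult_integrable:
  assumes "L2 \<Omega> f" "L2 \<Omega> g"
  shows "integrable (lebesgue_on \<Omega>) (\<lambda>x. f x * g x)"
proof (rule Bochner_Integration.integrable_bound)
  show "integrable (lebesgue_on \<Omega>) (\<lambda>x. (f x)\<^sup>2 + (g x)\<^sup>2)"
    using assms by (simp add: L2_def)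
  have "\<bar>a * b\<bar> \<le> a\<^sup>2 + b\<^sup>2" for a b :: real
    using sum_squares_bound[of "\<bar>a\<bar>" "\<bar>b\<bar>"] mult_nonneg_nonneg[of "\<bar>a\<bar>" "\<bar>b\<bar>"]
    unfolding abs_mult power2_abs by linarith
  then show "AE x in lebesgue_on \<Omega>. norm (f x * g x) \<le> norm ((f x)\<^sup>2 + (g x)\<^sup>2)"
    by simp
qed (use assms in \<open>auto simp: L2_def\<close>)

lemma L2_dominated:
  assumes f: "L2 \<Omega> f" and g: "g \<in> borel_measurable (lebesgue_on \<Omega>)" and le: "\<And>x. \<bar>g x\<bar> \<le> \<bar>f x\<bar>"
  shows "L2 \<Omega> g"
  unfolding L2_def
proof
  show "integrable (lebesgue_on \<Omega>) (\<lambda>x. (g x)\<^sup>2)"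
    by (rule Bochner_Integration.integrable_bound[OF L2_square_integrable[OF f]])
       (use g le in \<open>auto simp: abs_le_square_iff\<close>)
qed (rule g)

lemma L2_cmult: "L2 \<Omega> f \<Longrightarrow> L2 \<Omega> (\<lambda>x. c * f x)"
  by (auto simp: L2_def power_mult_distrib)

lemma L2_bounded_mult:
  assumes "L2 \<Omega> f" and "h \<in> borel_measurable (lebesgue_on \<Omega>)" and "\<And>x. \<bar>h x\<bar> \<le> B"
  shows "L2 \<Omega> (\<lambda>x. h x * f x)"
  by (rule L2_dominated[OF L2_cmult[OF assms(1), of B]])
     (use assms order_trans[OF assms(3) abs_ge_self] in \<open>auto simp: L2_def abs_mult intro!: mult_right_mono\<close>)

lemma L2_add: "L2 \<Omega> f \<Longrightarrow> L2 \<Omega> g \<Longrightarrow> L2 \<Omega> (\<lambda>x. f x + g x)"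
  using L2_mult_integrable[of \<Omega> f g] by (auto simp: L2_def power2_sum mult.assoc)

lemma L2_diff: "L2 \<Omega> f \<Longrightarrow> L2 \<Omega> g \<Longrightarrow> L2 \<Omega> (\<lambda>x. f x - g x)"
  using L2_add[OF _ L2_cmult[of \<Omega> g "-1"], of f] by simp

lemma L2_sum: "(\<And>i. i \<in> I \<Longrightarrow> L2 \<Omega> (f i)) \<Longrightarrow> L2 \<Omega> (\<lambda>x. \<Sum>i\<in>I. f i x)"
proof (induction I rule: infinite_finite_induct)
  case (insert i I)
  then show ?case by (simp add: L2_add)
qed (simp_all add: L2_def)

lemma L2_Cauchy_Schwarz:
  assumes f: "L2 \<Omega> f" and g: "L2 \<Omega> g"
  shows "(LINT x|lebesgue_on \<Omega>. f x * g x)\<^sup>2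
    \<le> (LINT x|lebesgue_on \<Omega>. (f x)\<^sup>2) * (LINT x|lebesgue_on \<Omega>. (g x)\<^sup>2)"
proof -
  let ?M = "lebesgue_on \<Omega>"
  have "ennreal ((LINT x|?M. f x * g x)\<^sup>2) = (ennreal \<bar>LINT x|?M. f x * g x\<bar>)\<^sup>2"
    by (simp add: ennreal_power)
  also have "\<dots> \<le> (\<integral>\<^sup>+x. ennreal \<bar>f x\<bar> * ennreal \<bar>g x\<bar> \<partial>?M)\<^sup>2"
    using integral_norm_bound_ennreal[OF L2_mult_integrable[OF f g]]
    by (intro power_mono) (simp_all add: abs_mult ennreal_mult)
  also have "\<dots> \<le> (\<integral>\<^sup>+x. (ennreal \<bar>f x\<bar>)\<^sup>2 \<partial>?M) * (\<integral>\<^sup>+x. (ennreal \<bar>g x\<bar>)\<^sup>2 \<partial>?M)"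
    using f g by (intro Cauchy_Schwarz_nn_integral) (auto simp: L2_def)
  also have "\<dots> = ennreal ((LINT x|?M. (f x)\<^sup>2) * (LINT x|?M. (g x)\<^sup>2))"
    using f g by (simp add: ennreal_power nn_integral_eq_integral L2_def ennreal_mult)
  finally show ?thesis by (subst (asm) ennreal_le_iff) auto
qed

definition L2_tendsto ::
  "'a::euclidean_space set \<Rightarrow> (nat \<Rightarrow> 'a \<Rightarrow> real) \<Rightarrow> ('a \<Rightarrow> real) \<Rightarrow> bool" where
  "L2_tendsto \<Omega> a f \<longleftrightarrow> (\<forall>n. L2 \<Omega> (a n)) \<and> L2 \<Omega> f \<and>
     (\<lambda>n. LINT x|lebesgue_on \<Omega>. (a n x - f x)\<^sup>2) \<longlonglongrightarrow> 0"

lemma L2_tendstoD: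
  assumes "L2_tendsto \<Omega> a f"
  shows "L2 \<Omega> (a n)" and "L2 \<Omega> f"
    and "(\<lambda>n. LINT x|lebesgue_on \<Omega>. (a n x - f x)\<^sup>2) \<longlonglongrightarrow> 0"
  using assms by (auto simp: L2_tendsto_def)

lemma L2_tendsto_subseq: "L2_tendsto \<Omega> a f \<Longrightarrow> strict_mono r \<Longrightarrow> L2_tendsto \<Omega> (\<lambda>n. a (r n)) f"
  using LIMSEQ_subseq_LIMSEQ by (fastforce simp: L2_tendsto_def o_def)

lemma L2_tendsto_comparison:
  assumes a: "\<And>n. L2 \<Omega> (a n)" and f: "L2 \<Omega> f"
    and e: "\<And>n. integrable (lebesgue_on \<Omega>) (e n)" "(\<lambda>n. LINT x|lebesgue_on \<Omega>. e n x) \<longlonglongrightarrow> 0"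
    and le: "\<And>n x. (a n x - f x)\<^sup>2 \<le> e n x"
  shows "L2_tendsto \<Omega> a f"
  unfolding L2_tendsto_def
proof (intro conjI allI a f)
  have "(LINT x|lebesgue_on \<Omega>. (a n x - f x)\<^sup>2) \<le> (LINT x|lebesgue_on \<Omega>. e n x)" for n
    by (intro integral_mono L2_square_integrable L2_diff a f e le)
  then show "(\<lambda>n. LINT x|lebesgue_on \<Omega>. (a n x - f x)\<^sup>2) \<longlonglongrightarrow> 0"
    by (intro tendsto_sandwich[OF _ _ tendsto_const e(2)]) simp_all
qed

lemma L2_dominated_convergence:
  assumes w: "L2 \<Omega> w" and m: "\<And>n. a n \<in> borel_measurable (lebesgue_on \<Omega>)"
      "f \<in> borel_measurable (lebesgue_on \<Omega>)"
    and le: "\<And>n x. \<bar>a n x\<bar> \<le> \<bar>w x\<bar>" "\<And>x. \<bar>f x\<bar> \<le> \<bar>w x\<bar>"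
    and lim: "AE x in lebesgue_on \<Omega>. (\<lambda>n. a n x) \<longlonglongrightarrow> f x"
  shows "L2_tendsto \<Omega> a f"
proof -
  have a: "L2 \<Omega> (a n)" for n by (rule L2_dominated[OF w m(1) le(1)])
  have f: "L2 \<Omega> f" by (rule L2_dominated[OF w m(2) le(2)])
  have "(\<lambda>n. LINT x|lebesgue_on \<Omega>. (a n x - f x)\<^sup>2) \<longlonglongrightarrow> (LINT x|lebesgue_on \<Omega>. 0)"
  proof (rule integral_dominated_convergence)
    show "integrable (lebesgue_on \<Omega>) (\<lambda>x. (2 * w x)\<^sup>2)"
      by (intro L2_square_integrable L2_cmult w)
    show "AE x in lebesgue_on \<Omega>. (\<lambda>n. (a n x - f x)\<^sup>2) \<longlonglongrightarrow> 0"
      using lim by eventually_elim (auto intro!: tendsto_null_power LIM_zero)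
    have "(a n x - f x)\<^sup>2 \<le> (2 * w x)\<^sup>2" for n x
      using le(1)[of n x] le(2)[of x] by (intro abs_le_square_iff[THEN iffD1]) linarith
    then show "AE x in lebesgue_on \<Omega>. norm ((a n x - f x)\<^sup>2) \<le> (2 * w x)\<^sup>2" for n
      by simp
  qed (use m in simp_all)
  with a f show ?thesis by (simp add: L2_tendsto_def)
qed

lemma L2_tendsto_compose:
  fixes T :: "nat \<Rightarrow> real \<Rightarrow> real"
  assumes [measurable]: "f \<in> borel_measurable (lebesgue_on \<Omega>)" "\<And>n. T n \<in> borel_measurable borel"
    and H: "L2 \<Omega> (\<lambda>x. H (f x))" and le: "\<And>n s. \<bar>T n s\<bar> \<le> \<bar>H s\<bar>" and lim: "\<And>s. (\<lambda>n. T n s) \<longlonglongrightarrow> H s"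
  shows "L2_tendsto \<Omega> (\<lambda>n x. T n (f x)) (\<lambda>x. H (f x))"
  by (rule L2_dominated_convergence[OF H]) (simp_all add: L2_measurable[OF H] le lim)

lemma L2_tendsto_integral_mult:
  assumes a: "L2_tendsto \<Omega> a f" and b: "L2 \<Omega> b"
  shows "(\<lambda>n. LINT x|lebesgue_on \<Omega>. a n x * b x) \<longlonglongrightarrow> (LINT x|lebesgue_on \<Omega>. f x * b x)"
proof -
  let ?M = "lebesgue_on \<Omega>"
  have diff: "(LINT x|?M. a n x * b x) - (LINT x|?M. f x * b x) = (LINT x|?M. (a n x - f x) * b x)" for n
    using L2_tendstoD[OF a] b by (simp add: left_diff_distrib L2_mult_integrable)
  have "(\<lambda>n. (LINT x|?M. (a n x - f x) * b x)\<^sup>2) \<longlonglongrightarrow> 0"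
  proof (rule Lim_null_comparison[OF always_eventually])
    show "(\<lambda>n. (LINT x|?M. (a n x - f x)\<^sup>2) * (LINT x|?M. (b x)\<^sup>2)) \<longlonglongrightarrow> 0"
      by (rule tendsto_mult_left_zero[OF L2_tendstoD(3)[OF a]])
    have "(LINT x|?M. (a n x - f x) * b x)\<^sup>2 \<le> (LINT x|?M. (a n x - f x)\<^sup>2) * (LINT x|?M. (b x)\<^sup>2)" for n
      by (intro L2_Cauchy_Schwarz L2_diff L2_tendstoD[OF a] b)
    then show "\<forall>n. norm ((LINT x|?M. (a n x - f x) * b x)\<^sup>2)
        \<le> (LINT x|?M. (a n x - f x)\<^sup>2) * (LINT x|?M. (b x)\<^sup>2)"
      by simp
  qed
  then have "(\<lambda>n. LINT x|?M. (a n x - f x) * b x) \<longlonglongrightarrow> 0" by simp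
  then show ?thesis unfolding diff[symmetric] by (rule LIM_zero_cancel)
qed

lemma L2_tendsto_integral_square:
  assumes a: "L2_tendsto \<Omega> a f"
  shows "(\<lambda>n. LINT x|lebesgue_on \<Omega>. (a n x)\<^sup>2) \<longlonglongrightarrow> (LINT x|lebesgue_on \<Omega>. (f x)\<^sup>2)"
proof -
  let ?M = "lebesgue_on \<Omega>"
  note L2 = L2_tendstoD(1,2)[OF a]
  have expand: "(LINT x|?M. (a n x)\<^sup>2)
      = (LINT x|?M. (a n x - f x)\<^sup>2) + 2 * (LINT x|?M. a n x * f x) - (LINT x|?M. (f x)\<^sup>2)" for n
  proof -
    have "(LINT x|?M. (a n x)\<^sup>2) = (LINT x|?M. (a n x - f x)\<^sup>2 + 2 * (a n x * f x) - (f x)\<^sup>2)"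
      by (intro Bochner_Integration.integral_cong) (auto simp: power2_diff)
    then show ?thesis
      using L2 L2_square_integrable[OF L2_diff[OF L2(1) L2(2)]]
      by (simp add: L2_mult_integrable L2_square_integrable)
  qed
  have "(\<lambda>n. (LINT x|?M. (a n x - f x)\<^sup>2) + 2 * (LINT x|?M. a n x * f x) - (LINT x|?M. (f x)\<^sup>2))
      \<longlonglongrightarrow> 0 + 2 * (LINT x|?M. f x * f x) - (LINT x|?M. (f x)\<^sup>2)"
    by (intro tendsto_intros L2_tendstoD(3)[OF a] L2_tendsto_integral_mult[OF a L2(2)])
  then show ?thesis unfolding expand by (simp add: power2_eq_square)
qed

lemma L2_tendsto_add:
  assumes a: "L2_tendsto \<Omega> a f" and b: "L2_tendsto \<Omega> b g"
  shows "L2_tendsto \<Omega> (\<lambda>n x. a n x + b n x) (\<lambda>x. f x + g x)"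
proof (rule L2_tendsto_comparison)
  let ?e = "\<lambda>n x. 2 * (a n x - f x)\<^sup>2 + 2 * (b n x - g x)\<^sup>2"
  note integrable = L2_square_integrable[OF L2_diff[OF L2_tendstoD(1,2)[OF a]]]
    L2_square_integrable[OF L2_diff[OF L2_tendstoD(1,2)[OF b]]]
  show "integrable (lebesgue_on \<Omega>) (?e n)" for n
    using integrable by simp
  show "(\<lambda>n. LINT x|lebesgue_on \<Omega>. ?e n x) \<longlonglongrightarrow> 0"
    using integrable
    by (auto intro!: tendsto_add_zero tendsto_mult_right_zero L2_tendstoD(3)[OF a] L2_tendstoD(3)[OF b])
  show "(a n x + b n x - (f x + g x))\<^sup>2 \<le> ?e n x" for n x
    using sum_squares_bound[of "a n x - f x" "b n x - g x"] power2_sum[of "a n x - f x" "b n x - g x"]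
    by (simp add: algebra_simps)
qed (intro L2_add L2_tendstoD[OF a] L2_tendstoD[OF b])+

lemma L2_tendsto_sum:
  assumes "\<And>i. i \<in> I \<Longrightarrow> L2_tendsto \<Omega> (a i) (f i)"
  shows "L2_tendsto \<Omega> (\<lambda>n x. \<Sum>i\<in>I. a i n x) (\<lambda>x. \<Sum>i\<in>I. f i x)"
  using assms
proof (induction I rule: infinite_finite_induct)
  case (insert i I)
  then show ?case by (simp add: L2_tendsto_add)
qed (simp_all add: L2_tendsto_def L2_def)

lemma L2_tendsto_cmult:
  assumes "L2_tendsto \<Omega> a f"
  shows "L2_tendsto \<Omega> (\<lambda>n x. c * a n x) (\<lambda>x. c * f x)"
  using assms
  by (auto simp: L2_tendsto_def L2_cmult power_mult_distrib intro: tendsto_mult_right_zero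
      simp flip: right_diff_distrib)

lemma L2_tendsto_bounded_mult:
  assumes a: "L2_tendsto \<Omega> a f"
    and m: "\<And>n. h n \<in> borel_measurable (lebesgue_on \<Omega>)" "k \<in> borel_measurable (lebesgue_on \<Omega>)"
    and B: "\<And>n x. \<bar>h n x\<bar> \<le> B" "\<And>x. \<bar>k x\<bar> \<le> B"
    and lim: "AE x in lebesgue_on \<Omega>. (\<lambda>n. h n x) \<longlonglongrightarrow> k x"
  shows "L2_tendsto \<Omega> (\<lambda>n x. h n x * a n x) (\<lambda>x. k x * f x)"
proof -
  have diff: "L2 \<Omega> (\<lambda>x. a n x - f x)" for n
    by (intro L2_diff L2_tendstoD[OF a])
  have bound: "\<bar>s * t\<bar> \<le> \<bar>B * t\<bar>" if "\<bar>s\<bar> \<le> B" for s t :: real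
    using that by (simp add: abs_mult mult_right_mono)
  have "L2_tendsto \<Omega> (\<lambda>n x. h n x * (a n x - f x)) (\<lambda>x. 0)"
  proof (rule L2_tendsto_comparison)
    show "L2 \<Omega> (\<lambda>x. h n x * (a n x - f x))" for n
      by (rule L2_bounded_mult[OF diff m(1) B(1)])
    show "integrable (lebesgue_on \<Omega>) (\<lambda>x. (B * (a n x - f x))\<^sup>2)" for n
      by (intro L2_square_integrable L2_cmult diff)
    show "(\<lambda>n. LINT x|lebesgue_on \<Omega>. (B * (a n x - f x))\<^sup>2) \<longlonglongrightarrow> 0"
      using tendsto_mult_right_zero[OF L2_tendstoD(3)[OF a], of "B\<^sup>2"] by (simp add: power_mult_distrib)
    show "(h n x * (a n x - f x) - 0)\<^sup>2 \<le> (B * (a n x - f x))\<^sup>2" for n x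
      using bound[OF B(1)] by (simp add: abs_le_square_iff)
  qed (simp add: L2_def)
  moreover have "L2_tendsto \<Omega> (\<lambda>n x. h n x * f x) (\<lambda>x. k x * f x)"
    using L2_tendstoD(2)[OF a, THEN L2_measurable] m lim
    by (intro L2_dominated_convergence[OF L2_cmult[OF L2_tendstoD(2)[OF a], of B]] bound B)
       (auto elim!: eventually_mono intro!: tendsto_intros)
  ultimately have "L2_tendsto \<Omega> (\<lambda>n x. h n x * (a n x - f x) + h n x * f x) (\<lambda>x. 0 + k x * f x)"
    by (rule L2_tendsto_add)
  then show ?thesis by (simp add: algebra_simps)
qed

lemma L2_tendsto_AE_subseq:
  assumes a: "L2_tendsto \<Omega> a f"
  obtains r where "strict_mono r" "AE x in lebesgue_on \<Omega>. (\<lambda>n. a (r n) x) \<longlonglongrightarrow> f x"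
proof -
  have "\<exists>r. strict_mono r \<and> (AE x in lebesgue_on \<Omega>. (\<lambda>n. (a (r n) x - f x)\<^sup>2) \<longlonglongrightarrow> 0)"
    using L2_tendstoD(3)[OF a] L2_square_integrable[OF L2_diff[OF L2_tendstoD(1,2)[OF a]]]
    by (intro tendsto_L1_AE_subseq) simp_all
  then show ?thesis using that by (auto simp: LIM_zero_iff)
qed

lemma norm_square_components: "(norm (x::'a::euclidean_space))\<^sup>2 = (\<Sum>j\<in>Basis. (x \<bullet> j)\<^sup>2)"
  unfolding power2_norm_eq_inner by (subst euclidean_inner) (simp add: power2_eq_square)

lemma L2v_iff_components: "L2v \<Omega> u \<longleftrightarrow> (\<forall>j\<in>Basis. L2 \<Omega> (\<lambda>x. u x \<bullet> j))"
proof
  assume "L2v \<Omega> u"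
  then have [measurable]: "u \<in> borel_measurable (lebesgue_on \<Omega>)" and norm: "L2 \<Omega> (\<lambda>x. norm (u x))"
    by (auto simp: L2_def L2v_def)
  show "\<forall>j\<in>Basis. L2 \<Omega> (\<lambda>x. u x \<bullet> j)"
    by (intro ballI L2_dominated[OF norm]) (simp_all add: Basis_le_norm)
next
  assume c: "\<forall>j\<in>Basis. L2 \<Omega> (\<lambda>x. u x \<bullet> j)"
  then have "u \<in> borel_measurable (lebesgue_on \<Omega>)"
    by (subst borel_measurable_euclidean_space) (simp add: L2_def)
  with c show "L2v \<Omega> u"
    unfolding L2v_def norm_square_components by (simp add: L2_def)
qed

lemma L2v_component: "L2v \<Omega> u \<Longrightarrow> j \<in> Basis \<Longrightarrow> L2 \<Omega> (\<lambda>x. u x \<bullet> j)"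
  by (simp add: L2v_iff_components)

lemma L2v_lincomb: "L2v \<Omega> u \<Longrightarrow> L2v \<Omega> v \<Longrightarrow> L2v \<Omega> (\<lambda>x. a *\<^sub>R u x + b *\<^sub>R v x)"
  unfolding L2v_iff_components inner_add_left inner_scaleR_left by (intro ballI L2_add L2_cmult) simp_all

lemma L2v_diff: "L2v \<Omega> u \<Longrightarrow> L2v \<Omega> v \<Longrightarrow> L2v \<Omega> (\<lambda>x. u x - v x)"
  using L2v_lincomb[of \<Omega> u v 1 "-1"] by simp

lemma L2v_norm_square_integrable: "L2v \<Omega> u \<Longrightarrow> integrable (lebesgue_on \<Omega>) (\<lambda>x. (norm (u x))\<^sup>2)"
  by (simp add: L2v_def)

lemma L2v_norm_square_integral:
  assumes "L2v \<Omega> u"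
  shows "(LINT x|lebesgue_on \<Omega>. (norm (u x))\<^sup>2) = (\<Sum>j\<in>Basis. LINT x|lebesgue_on \<Omega>. (u x \<bullet> j)\<^sup>2)"
  unfolding norm_square_components
  by (rule Bochner_Integration.integral_sum) (rule L2_square_integrable[OF L2v_component[OF assms]])

lemma
  assumes "L2v \<Omega> u" "L2v \<Omega> v"
  shows L2v_inner_integrable: "integrable (lebesgue_on \<Omega>) (\<lambda>x. u x \<bullet> v x)"
    and L2v_inner_integral: "(LINT x|lebesgue_on \<Omega>. u x \<bullet> v x)
      = (\<Sum>j\<in>Basis. LINT x|lebesgue_on \<Omega>. (u x \<bullet> j) * (v x \<bullet> j))"
  unfolding euclidean_inner[of "u _" "v _"]
  by (intro Bochner_Integration.integrable_sum Bochner_Integration.integral_sum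
      L2_mult_integrable L2v_component assms; assumption)+

definition L2v_tendsto ::
  "'a::euclidean_space set \<Rightarrow> (nat \<Rightarrow> 'a \<Rightarrow> 'a) \<Rightarrow> ('a \<Rightarrow> 'a) \<Rightarrow> bool" where
  "L2v_tendsto \<Omega> a u \<longleftrightarrow> (\<forall>n. L2v \<Omega> (a n)) \<and> L2v \<Omega> u \<and>
     (\<lambda>n. LINT x|lebesgue_on \<Omega>. (norm (a n x - u x))\<^sup>2) \<longlonglongrightarrow> 0"

lemma tendsto_sum_nonneg_zero_iff:
  fixes s :: "'i \<Rightarrow> 'b \<Rightarrow> real"
  assumes "finite I" and nonneg: "\<And>i n. i \<in> I \<Longrightarrow> 0 \<le> s i n"
  shows "((\<lambda>n. \<Sum>i\<in>I. s i n) \<longlongrightarrow> 0) \<F> \<longleftrightarrow> (\<forall>i\<in>I. (s i \<longlongrightarrow> 0) \<F>)"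
proof safe
  fix i assume sum: "((\<lambda>n. \<Sum>i\<in>I. s i n) \<longlongrightarrow> 0) \<F>" and i: "i \<in> I"
  have "s i n \<le> (\<Sum>i\<in>I. s i n)" for n
    using assms i by (intro member_le_sum) auto
  then show "(s i \<longlongrightarrow> 0) \<F>"
    using nonneg[OF i] by (intro tendsto_sandwich[OF _ _ tendsto_const sum]) simp_all
qed (simp add: tendsto_null_sum)

lemma L2v_tendsto_iff_components:
  "L2v_tendsto \<Omega> a u \<longleftrightarrow> (\<forall>j\<in>Basis. L2_tendsto \<Omega> (\<lambda>n x. a n x \<bullet> j) (\<lambda>x. u x \<bullet> j))"
proof (cases "(\<forall>n. L2v \<Omega> (a n)) \<and> L2v \<Omega> u")
  case True
  then have "(LINT x|lebesgue_on \<Omega>. (norm (a n x - u x))\<^sup>2)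
      = (\<Sum>j\<in>Basis. LINT x|lebesgue_on \<Omega>. (a n x \<bullet> j - u x \<bullet> j)\<^sup>2)" for n
    by (simp add: L2v_norm_square_integral L2v_diff inner_diff_left)
  with True show ?thesis
    by (simp add: L2v_tendsto_def L2_tendsto_def L2v_component tendsto_sum_nonneg_zero_iff)
next
  case False
  then show ?thesis
    by (auto simp: L2v_tendsto_def L2_tendsto_def L2v_iff_components)
qed

lemma L2v_tendsto_component:
  "L2v_tendsto \<Omega> a u \<Longrightarrow> j \<in> Basis \<Longrightarrow> L2_tendsto \<Omega> (\<lambda>n x. a n x \<bullet> j) (\<lambda>x. u x \<bullet> j)"
  by (simp add: L2v_tendsto_iff_components)

lemma L2v_tendsto_integral_inner:
  assumes a: "L2v_tendsto \<Omega> a u" and v: "L2v \<Omega> v"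
  shows "(\<lambda>n. LINT x|lebesgue_on \<Omega>. a n x \<bullet> v x) \<longlonglongrightarrow> (LINT x|lebesgue_on \<Omega>. u x \<bullet> v x)"
proof -
  have "L2v \<Omega> (a n)" "L2v \<Omega> u" for n using a by (auto simp: L2v_tendsto_def)
  then show ?thesis
    by (simp add: L2v_inner_integral v)
       (intro tendsto_sum L2_tendsto_integral_mult L2v_tendsto_component[OF a] L2v_component[OF v])
qed

section \<open>Weak derivatives\<close>

definition weak_partial ::
  "'a::euclidean_space set \<Rightarrow> 'a \<Rightarrow> ('a \<Rightarrow> real) \<Rightarrow> ('a \<Rightarrow> real) \<Rightarrow> bool" where
  "weak_partial \<Omega> i f g \<longleftrightarrow> (\<forall>\<phi>. test_fun \<Omega> \<phi> \<longrightarrow>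
     (LINT x|lebesgue_on \<Omega>. f x * partial i \<phi> x) = - (LINT x|lebesgue_on \<Omega>. g x * \<phi> x))"

lemma weak_grad_iff_components:
  "weak_grad \<Omega> u Du \<longleftrightarrow> (\<forall>i\<in>Basis. \<forall>j\<in>Basis. weak_partial \<Omega> i (\<lambda>x. u x \<bullet> j) (\<lambda>x. Du x i \<bullet> j))"
  by (simp add: weak_grad_def weak_partial_def)

text \<open>The weak gradient property is not part of the definition because it follows from the
  approximation by test functions.\<close>
definition scalar_H10 ::
  "'a::euclidean_space set \<Rightarrow> ('a \<Rightarrow> real) \<Rightarrow> ('a \<Rightarrow> 'a \<Rightarrow> real) \<Rightarrow> bool" where
  "scalar_H10 \<Omega> f g \<longleftrightarrow> (\<exists>\<psi>. (\<forall>n. test_fun \<Omega> (\<psi> n)) \<and> L2_tendsto \<Omega> \<psi> f \<and>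
     (\<forall>i\<in>Basis. L2_tendsto \<Omega> (\<lambda>n. partial i (\<psi> n)) (\<lambda>x. g x i)))"

lemma scalar_H10E:
  assumes "scalar_H10 \<Omega> f g"
  obtains \<psi> where "\<And>n. test_fun \<Omega> (\<psi> n)" "L2_tendsto \<Omega> \<psi> f"
    "\<And>i. i \<in> Basis \<Longrightarrow> L2_tendsto \<Omega> (\<lambda>n. partial i (\<psi> n)) (\<lambda>x. g x i)"
  using assms unfolding scalar_H10_def by blast

lemma scalar_H10_AE_E:
  assumes "scalar_H10 \<Omega> f g"
  obtains \<psi> where "\<And>n. test_fun \<Omega> (\<psi> n)" "L2_tendsto \<Omega> \<psi> f"
    "\<And>i. i \<in> Basis \<Longrightarrow> L2_tendsto \<Omega> (\<lambda>n. partial i (\<psi> n)) (\<lambda>x. g x i)"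
    "AE x in lebesgue_on \<Omega>. (\<lambda>n. \<psi> n x) \<longlonglongrightarrow> f x"
proof -
  obtain \<psi> where \<psi>: "\<And>n. test_fun \<Omega> (\<psi> n)" "L2_tendsto \<Omega> \<psi> f"
    "\<And>i. i \<in> Basis \<Longrightarrow> L2_tendsto \<Omega> (\<lambda>n. partial i (\<psi> n)) (\<lambda>x. g x i)"
    using scalar_H10E[OF assms] by blast
  obtain r where r: "strict_mono r" "AE x in lebesgue_on \<Omega>. (\<lambda>n. \<psi> (r n) x) \<longlonglongrightarrow> f x"
    using L2_tendsto_AE_subseq[OF \<psi>(2)] by blast
  show ?thesis
    using that[OF \<psi>(1) L2_tendsto_subseq[OF \<psi>(2) r(1)] L2_tendsto_subseq[OF \<psi>(3) r(1)] r(2)] .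
qed

lemma scalar_H10_L2: "scalar_H10 \<Omega> f g \<Longrightarrow> L2 \<Omega> f"
  by (auto elim: scalar_H10E dest: L2_tendstoD(2))

lemma scalar_H10_grad_L2: "scalar_H10 \<Omega> f g \<Longrightarrow> i \<in> Basis \<Longrightarrow> L2 \<Omega> (\<lambda>x. g x i)"
  by (metis scalar_H10E L2_tendstoD(2))

lemma partial_test_fun_mult:
  assumes "test_fun \<Omega> f" "test_fun \<Omega> g"
  shows "partial i (\<lambda>x. f x * g x) x = f x * partial i g x + partial i f x * g x"
  using frechet_derivative_at[OF has_derivative_mult[OF test_fun_has_derivative[OF assms(1)]
      test_fun_has_derivative[OF assms(2)], of x]] by metis

lemma partial_test_fun_lincomb:
  assumes "test_fun \<Omega> f" "test_fun \<Omega> g"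
  shows "partial i (\<lambda>x. a * f x + b * g x) x = a * partial i f x + b * partial i g x"
  using frechet_derivative_at[OF has_derivative_add[OF
      has_derivative_mult_right[OF test_fun_has_derivative[OF assms(1)], of a]
      has_derivative_mult_right[OF test_fun_has_derivative[OF assms(2)], of b], of x]] by metis

lemma scalar_H10_lincomb:
  assumes "scalar_H10 \<Omega> f f'" "scalar_H10 \<Omega> g g'"
  shows "scalar_H10 \<Omega> (\<lambda>x. a * f x + b * g x) (\<lambda>x i. a * f' x i + b * g' x i)"
proof -
  obtain \<phi> where \<phi>: "\<And>n. test_fun \<Omega> (\<phi> n)" "L2_tendsto \<Omega> \<phi> f"
    "\<And>i. i \<in> Basis \<Longrightarrow> L2_tendsto \<Omega> (\<lambda>n. partial i (\<phi> n)) (\<lambda>x. f' x i)"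
    using scalar_H10E[OF assms(1)] by blast
  obtain \<psi> where \<psi>: "\<And>n. test_fun \<Omega> (\<psi> n)" "L2_tendsto \<Omega> \<psi> g"
    "\<And>i. i \<in> Basis \<Longrightarrow> L2_tendsto \<Omega> (\<lambda>n. partial i (\<psi> n)) (\<lambda>x. g' x i)"
    using scalar_H10E[OF assms(2)] by blast
  show ?thesis
    unfolding scalar_H10_def
  proof (intro exI conjI allI ballI)
    show "test_fun \<Omega> (\<lambda>x. a * \<phi> n x + b * \<psi> n x)" for n
      by (intro test_fun_lincomb \<phi> \<psi>)
    show "L2_tendsto \<Omega> (\<lambda>n x. a * \<phi> n x + b * \<psi> n x) (\<lambda>x. a * f x + b * g x)"
      by (intro L2_tendsto_add L2_tendsto_cmult \<phi> \<psi>)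
    show "L2_tendsto \<Omega> (\<lambda>n. partial i (\<lambda>x. a * \<phi> n x + b * \<psi> n x)) (\<lambda>x. a * f' x i + b * g' x i)"
      if "i \<in> Basis" for i
      unfolding partial_test_fun_lincomb[OF \<phi>(1) \<psi>(1)]
      by (intro L2_tendsto_add L2_tendsto_cmult \<phi> \<psi> that)
  qed
qed

lemma L2_tendsto_Lipschitz_compose:
  assumes a: "L2_tendsto \<Omega> a f" and G: "G 0 = 0" and lip: "\<And>s t. \<bar>G s - G t\<bar> \<le> B * \<bar>s - t\<bar>"
    and [measurable]: "G \<in> borel_measurable borel"
  shows "L2_tendsto \<Omega> (\<lambda>n x. G (a n x)) (\<lambda>x. G (f x))"
proof (rule L2_tendsto_comparison)
  have "B \<ge> 0" using lip[of 1 0] by simp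
  have compose: "L2 \<Omega> (\<lambda>x. G (h x))" if "L2 \<Omega> h" for h
    using lip[of _ 0] G \<open>B \<ge> 0\<close> L2_measurable[OF that]
    by (intro L2_dominated[OF L2_cmult[OF that, of B]]) (simp_all add: abs_mult)
  show "L2 \<Omega> (\<lambda>x. G (a n x))" "L2 \<Omega> (\<lambda>x. G (f x))" for n
    by (intro compose L2_tendstoD[OF a])+
  show "integrable (lebesgue_on \<Omega>) (\<lambda>x. B\<^sup>2 * (a n x - f x)\<^sup>2)" for n
    by (intro integrable_mult_right L2_square_integrable L2_diff L2_tendstoD[OF a])
  show "(\<lambda>n. LINT x|lebesgue_on \<Omega>. B\<^sup>2 * (a n x - f x)\<^sup>2) \<longlonglongrightarrow> 0"
    using tendsto_mult_right_zero[OF L2_tendstoD(3)[OF a]] by simp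
  show "(G (a n x) - G (f x))\<^sup>2 \<le> B\<^sup>2 * (a n x - f x)\<^sup>2" for n x
    using power_mono[OF lip, of "a n x" "f x" 2] by (simp add: power_mult_distrib)
qed

locale lebesgue_domain =
  fixes \<Omega> :: "'a::euclidean_space set"
  assumes sets_lebesgue: "\<Omega> \<in> sets lebesgue"
begin

lemma test_fun_integral_lborel: "test_fun \<Omega> f \<Longrightarrow> (LINT x|lebesgue_on \<Omega>. f x) = (LINT x|lborel. f x)"
  by (intro integral_lebesgue_on_eq_lborel[OF sets_lebesgue] test_fun_measurable test_fun_zero_outside)

lemma test_fun_integrable: "test_fun \<Omega> f \<Longrightarrow> integrable (lebesgue_on \<Omega>) f"
  using integrable_lebesgue_on_eq_lborel[OF sets_lebesgue, of f] test_fun_measurable test_fun_zero_outside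
    test_fun_integrable_lborel by blast

lemma test_fun_L2: "test_fun \<Omega> f \<Longrightarrow> L2 \<Omega> f"
  unfolding L2_def power2_eq_square
  by (intro conjI test_fun_integrable test_fun_mult borel_measurable_lebesgue_on test_fun_measurable)

lemma test_fun_weak_partial:
  assumes f: "test_fun \<Omega> f" and i: "i \<in> Basis"
  shows "weak_partial \<Omega> i f (partial i f)"
  unfolding weak_partial_def
proof (intro allI impI)
  fix \<phi> assume \<phi>: "test_fun \<Omega> \<phi>"
  have "0 = (LINT x|lebesgue_on \<Omega>. partial i (\<lambda>x. f x * \<phi> x) x)"
    using integral_test_fun_partial[OF test_fun_mult[OF f \<phi>] i]
    by (simp add: test_fun_integral_lborel[OF test_fun_partial[OF test_fun_mult[OF f \<phi>] i]])
  also have "\<dots> = (LINT x|lebesgue_on \<Omega>. f x * partial i \<phi> x) + (LINT x|lebesgue_on \<Omega>. partial i f x * \<phi> x)"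
    unfolding partial_test_fun_mult[OF f \<phi>]
    by (intro Bochner_Integration.integral_add L2_mult_integrable test_fun_L2 test_fun_partial f \<phi> i)
  finally show "(LINT x|lebesgue_on \<Omega>. f x * partial i \<phi> x) = - (LINT x|lebesgue_on \<Omega>. partial i f x * \<phi> x)"
    by simp
qed

lemma weak_partial_lincomb:
  assumes weak: "weak_partial \<Omega> i f f'" "weak_partial \<Omega> i g g'"
    and L2: "L2 \<Omega> f" "L2 \<Omega> f'" "L2 \<Omega> g" "L2 \<Omega> g'" and i: "i \<in> Basis"
  shows "weak_partial \<Omega> i (\<lambda>x. a * f x + b * g x) (\<lambda>x. a * f' x + b * g' x)"
  unfolding weak_partial_def
proof (intro allI impI)
  fix \<phi> assume \<phi>: "test_fun \<Omega> \<phi>"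
  have linear: "(LINT x|lebesgue_on \<Omega>. (a * p x + b * q x) * h x)
      = a * (LINT x|lebesgue_on \<Omega>. p x * h x) + b * (LINT x|lebesgue_on \<Omega>. q x * h x)"
    if "L2 \<Omega> p" "L2 \<Omega> q" "L2 \<Omega> h" for p q h
    using L2_mult_integrable[OF that(1,3)] L2_mult_integrable[OF that(2,3)]
    by (simp add: distrib_right mult.assoc)
  show "(LINT x|lebesgue_on \<Omega>. (a * f x + b * g x) * partial i \<phi> x)
      = - (LINT x|lebesgue_on \<Omega>. (a * f' x + b * g' x) * \<phi> x)"
    using weak \<phi> by (simp add: linear L2 test_fun_L2 test_fun_partial i weak_partial_def)
qed

lemma scalar_H10_integration_by_parts:
  assumes f: "scalar_H10 \<Omega> f g" and w: "weak_partial \<Omega> i w w'" "L2 \<Omega> w" "L2 \<Omega> w'" and i: "i \<in> Basis"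
  shows "(LINT x|lebesgue_on \<Omega>. w x * g x i) = - (LINT x|lebesgue_on \<Omega>. w' x * f x)"
proof -
  let ?M = "lebesgue_on \<Omega>"
  obtain \<psi> where \<psi>: "\<And>n. test_fun \<Omega> (\<psi> n)" "L2_tendsto \<Omega> \<psi> f"
    "L2_tendsto \<Omega> (\<lambda>n. partial i (\<psi> n)) (\<lambda>x. g x i)"
    using scalar_H10E[OF f] i by metis
  have "(\<lambda>n. LINT x|?M. partial i (\<psi> n) x * w x) \<longlonglongrightarrow> (LINT x|?M. g x i * w x)"
    by (rule L2_tendsto_integral_mult[OF \<psi>(3) w(2)])
  moreover have "(\<lambda>n. - (LINT x|?M. \<psi> n x * w' x)) \<longlonglongrightarrow> - (LINT x|?M. f x * w' x)"
    by (intro tendsto_minus L2_tendsto_integral_mult[OF \<psi>(2) w(3)])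
  moreover have "(LINT x|?M. partial i (\<psi> n) x * w x) = - (LINT x|?M. \<psi> n x * w' x)" for n
    using w(1) \<psi>(1) by (simp add: weak_partial_def mult.commute)
  ultimately show ?thesis
    using LIMSEQ_unique by (simp add: mult.commute)
qed

lemma scalar_H10_weak_partial:
  assumes f: "scalar_H10 \<Omega> f g" and i: "i \<in> Basis"
  shows "weak_partial \<Omega> i f (\<lambda>x. g x i)"
  unfolding weak_partial_def
proof (intro allI impI)
  fix \<phi> assume \<phi>: "test_fun \<Omega> \<phi>"
  have "(LINT x|lebesgue_on \<Omega>. \<phi> x * g x i) = - (LINT x|lebesgue_on \<Omega>. partial i \<phi> x * f x)"
    by (intro scalar_H10_integration_by_parts[OF f] test_fun_weak_partial test_fun_L2 test_fun_partial \<phi> i)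
  then show "(LINT x|lebesgue_on \<Omega>. f x * partial i \<phi> x) = - (LINT x|lebesgue_on \<Omega>. g x i * \<phi> x)"
    by (simp add: mult.commute)
qed

lemma scalar_H10_compose:
  fixes G G' :: "real \<Rightarrow> real"
  assumes f: "scalar_H10 \<Omega> f g" and G: "smooth_fun G" "G 0 = 0"
    and G': "\<And>s. (G has_real_derivative G' s) (at s)" "\<And>s. \<bar>G' s\<bar> \<le> B"
  shows "scalar_H10 \<Omega> (\<lambda>x. G (f x)) (\<lambda>x i. G' (f x) * g x i)"
proof -
  obtain \<psi> where \<psi>: "\<And>n. test_fun \<Omega> (\<psi> n)" "L2_tendsto \<Omega> \<psi> f"
    "\<And>i. i \<in> Basis \<Longrightarrow> L2_tendsto \<Omega> (\<lambda>n. partial i (\<psi> n)) (\<lambda>x. g x i)"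
    "AE x in lebesgue_on \<Omega>. (\<lambda>n. \<psi> n x) \<longlonglongrightarrow> f x"
    using scalar_H10_AE_E[OF f] by blast
  have "partial 1 G = G'"
    using frechet_derivative_at[OF has_field_derivative_imp_has_derivative[OF G'(1)], symmetric] by simp
  then have cont: "continuous_on UNIV G" "continuous_on UNIV G'"
    using smooth_fun_continuous smooth_fun_partial[OF G(1), of 1] G(1) by auto
  note [measurable] = cont[THEN borel_measurable_continuous_onI]
    L2_tendstoD(1,2)[OF \<psi>(2), THEN L2_measurable]
  have chain: "partial i (\<lambda>x. G (\<psi> n x)) x = G' (\<psi> n x) * partial i (\<psi> n) x" for i n x
    using frechet_derivative_at[OF has_derivative_compose_real[OF test_fun_has_derivative[OF \<psi>(1)] G'(1)]]
    by metis
  show ?thesis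
    unfolding scalar_H10_def
  proof (intro exI conjI allI ballI)
    show "test_fun \<Omega> (\<lambda>x. G (\<psi> n x))" for n
      by (rule test_fun_compose[OF G \<psi>(1)])
    have "\<bar>G s - G t\<bar> \<le> B * \<bar>s - t\<bar>" for s t
      using field_differentiable_bound[of UNIV G G' B s t] G'
      by (auto intro: has_field_derivative_at_within)
    then show "L2_tendsto \<Omega> (\<lambda>n x. G (\<psi> n x)) (\<lambda>x. G (f x))"
      by (intro L2_tendsto_Lipschitz_compose[where G = G] \<psi>(2) G(2)) simp_all
    show "L2_tendsto \<Omega> (\<lambda>n. partial i (\<lambda>x. G (\<psi> n x))) (\<lambda>x. G' (f x) * g x i)" if "i \<in> Basis" for i
      unfolding chain
    proof (rule L2_tendsto_bounded_mult[where B = B, OF \<psi>(3)[OF that]])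
      have "isCont G' s" for s using cont(2) by (simp add: continuous_on_eq_continuous_at)
      then show "AE x in lebesgue_on \<Omega>. (\<lambda>n. G' (\<psi> n x)) \<longlonglongrightarrow> G' (f x)"
        using \<psi>(4) by (auto elim!: eventually_mono intro: isCont_tendsto_compose)
    qed (simp_all add: G'(2))
  qed
qed

end

section \<open>Ladyzhenskaya's inequality\<close>

lemma borel_measurable_PiM_sum_scaleR:
  "(\<lambda>z. \<Sum>b\<in>I. z b *\<^sub>R (b::'a::euclidean_space)) \<in> borel_measurable (\<Pi>\<^sub>M b\<in>I. lborel)"
proof (intro borel_measurable_sum borel_measurable_scaleR borel_measurable_const)
  show "(\<lambda>z. z b :: real) \<in> borel_measurable (\<Pi>\<^sub>M b\<in>I. lborel)" if "b \<in> I" for b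
    using measurable_component_singleton[OF that, of "\<lambda>_. lborel :: real measure"] by simp
qed

lemma nn_integral_PiM_insert_sum:
  fixes f :: "'a::euclidean_space \<Rightarrow> ennreal"
  assumes J: "finite J" "i \<notin> J" and f: "f \<in> borel_measurable borel"
  shows "(\<integral>\<^sup>+z. f (\<Sum>b\<in>insert i J. z b *\<^sub>R b) \<partial>(\<Pi>\<^sub>M b\<in>insert i J. lborel))
    = (\<integral>\<^sup>+t. \<integral>\<^sup>+z. f (t *\<^sub>R i + (\<Sum>b\<in>J. z b *\<^sub>R b)) \<partial>(\<Pi>\<^sub>M b\<in>J. lborel) \<partial>lborel)"
proof -
  interpret product_sigma_finite "\<lambda>_::'a. lborel :: real measure" by standard
  have "(\<lambda>z. f (\<Sum>b\<in>insert i J. z b *\<^sub>R b)) \<in> borel_measurable (\<Pi>\<^sub>M b\<in>insert i J. lborel)"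
    by (rule measurable_compose[OF borel_measurable_PiM_sum_scaleR f])
  moreover have "(\<Sum>b\<in>J. (z(i := t)) b *\<^sub>R b) = (\<Sum>b\<in>J. z b *\<^sub>R b)" for z t
    using J(2) by (intro sum.cong) auto
  ultimately show ?thesis
    using J by (subst product_nn_integral_insert_rev) simp_all
qed

lemma nn_integral_lborel_Basis:
  fixes f :: "'a::euclidean_space \<Rightarrow> ennreal"
  assumes "f \<in> borel_measurable borel"
  shows "(\<integral>\<^sup>+x. f x \<partial>lborel) = (\<integral>\<^sup>+z. f (\<Sum>b\<in>Basis. z b *\<^sub>R b) \<partial>(\<Pi>\<^sub>M b\<in>(Basis::'a set). lborel))"
  using assms by (subst lborel_eq, subst nn_integral_distr) (simp_all add: borel_measurable_PiM_sum_scaleR)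

definition plane :: "'a::real_vector \<Rightarrow> 'a \<Rightarrow> real \<times> real \<Rightarrow> 'a" where
  "plane a b z = fst z *\<^sub>R a + snd z *\<^sub>R b"

lemma plane_measurable [measurable]:
  "plane (a::'a::euclidean_space) b \<in> borel_measurable borel"
  unfolding plane_def[abs_def] by (intro borel_measurable_continuous_onI continuous_intros)

lemma nn_integral_lborel_pair:
  fixes f :: "'a::euclidean_space \<times> 'b::euclidean_space \<Rightarrow> ennreal"
  assumes "f \<in> borel_measurable borel"
  shows "(\<integral>\<^sup>+z. f z \<partial>lborel) = (\<integral>\<^sup>+s. \<integral>\<^sup>+t. f (s, t) \<partial>lborel \<partial>lborel)"
    and "(\<integral>\<^sup>+z. f z \<partial>lborel) = (\<integral>\<^sup>+t. \<integral>\<^sup>+s. f (s, t) \<partial>lborel \<partial>lborel)"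
  using assms lborel.nn_integral_fst[of f lborel] lborel_pair.nn_integral_snd[of f]
  by (simp_all add: lborel_prod borel_prod)

lemma nn_integral_PiM_plane:
  fixes f :: "'a::euclidean_space \<Rightarrow> ennreal"
  assumes "a \<noteq> b" and f[measurable]: "f \<in> borel_measurable borel"
  shows "(\<integral>\<^sup>+z. f (x + (\<Sum>b\<in>{a, b}. z b *\<^sub>R b)) \<partial>(\<Pi>\<^sub>M b\<in>{a, b}. lborel))
    = (\<integral>\<^sup>+z. f (x + plane a b z) \<partial>lborel)"
proof -
  interpret product_sigma_finite "\<lambda>_::'a. lborel :: real measure" by standard
  have "(\<integral>\<^sup>+z. f (x + (\<Sum>b\<in>{a, b}. z b *\<^sub>R b)) \<partial>(\<Pi>\<^sub>M b\<in>{a, b}. lborel))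
      = (\<integral>\<^sup>+s. \<integral>\<^sup>+z. f (x + (s *\<^sub>R a + (\<Sum>b\<in>{b}. z b *\<^sub>R b))) \<partial>(\<Pi>\<^sub>M b\<in>{b}. lborel) \<partial>lborel)"
    using \<open>a \<noteq> b\<close> by (intro nn_integral_PiM_insert_sum) simp_all
  also have "\<dots> = (\<integral>\<^sup>+s. \<integral>\<^sup>+t. f (x + plane a b (s, t)) \<partial>lborel \<partial>lborel)"
  proof (rule nn_integral_cong)
    show "(\<integral>\<^sup>+z. f (x + (s *\<^sub>R a + (\<Sum>b\<in>{b}. z b *\<^sub>R b))) \<partial>(\<Pi>\<^sub>M b\<in>{b}. lborel))
        = (\<integral>\<^sup>+t. f (x + plane a b (s, t)) \<partial>lborel)" for s
      using product_nn_integral_singleton[of "\<lambda>t. f (x + plane a b (s, t))" b] by (simp add: plane_def)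
  qed
  also have "\<dots> = (\<integral>\<^sup>+z. f (x + plane a b z) \<partial>lborel)"
    by (rule nn_integral_lborel_pair(1)[symmetric]) measurable
  finally show ?thesis .
qed

lemma nn_integral_lborel_plane:
  fixes f :: "'a::euclidean_space \<Rightarrow> ennreal"
  assumes "(Basis :: 'a set) = {a, b}" "a \<noteq> b" and "f \<in> borel_measurable borel"
  shows "(\<integral>\<^sup>+x. f x \<partial>lborel) = (\<integral>\<^sup>+z. f (plane a b z) \<partial>lborel)"
  using nn_integral_lborel_Basis[OF assms(3)] nn_integral_PiM_plane[OF assms(2,3), of 0] assms(1) by simp

lemma nn_integral_lborel_axis_plane:
  fixes f :: "'a::euclidean_space \<Rightarrow> ennreal"
  assumes B: "(Basis :: 'a set) = {a, b, c}" "a \<noteq> b" "a \<noteq> c" "b \<noteq> c" and f: "f \<in> borel_measurable borel"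
  shows "(\<integral>\<^sup>+x. f x \<partial>lborel) = (\<integral>\<^sup>+r. \<integral>\<^sup>+z. f (r *\<^sub>R c + plane a b z) \<partial>lborel \<partial>lborel)"
proof -
  have "(Basis :: 'a set) = insert c {a, b}" using B(1) by auto
  then have "(\<integral>\<^sup>+x. f x \<partial>lborel) = (\<integral>\<^sup>+z. f (\<Sum>b\<in>insert c {a, b}. z b *\<^sub>R b) \<partial>(\<Pi>\<^sub>M b\<in>insert c {a, b}. lborel))"
    using nn_integral_lborel_Basis[OF f] by simp
  also have "\<dots> = (\<integral>\<^sup>+r. \<integral>\<^sup>+z. f (r *\<^sub>R c + (\<Sum>b\<in>{a, b}. z b *\<^sub>R b)) \<partial>(\<Pi>\<^sub>M b\<in>{a, b}. lborel) \<partial>lborel)"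
    using B by (intro nn_integral_PiM_insert_sum f) auto
  finally show ?thesis by (simp only: nn_integral_PiM_plane[OF B(2) f])
qed

lemma nn_integral_square_le_pair:
  fixes q A B :: "'a::euclidean_space \<times> 'b::euclidean_space \<Rightarrow> ennreal"
  assumes [measurable]: "A \<in> borel_measurable borel" "B \<in> borel_measurable borel"
    and A: "\<And>s t. q (s, t) \<le> (\<integral>\<^sup>+s. A (s, t) \<partial>lborel)" and B: "\<And>s t. q (s, t) \<le> (\<integral>\<^sup>+t. B (s, t) \<partial>lborel)"
  shows "(\<integral>\<^sup>+z. (q z)\<^sup>2 \<partial>lborel) \<le> (\<integral>\<^sup>+z. A z \<partial>lborel) * (\<integral>\<^sup>+z. B z \<partial>lborel)"
proof -
  have [measurable]: "A \<in> borel_measurable (borel \<Otimes>\<^sub>M borel)" "B \<in> borel_measurable (borel \<Otimes>\<^sub>M borel)"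
    by (simp_all add: borel_prod)
  define \<alpha> \<beta> where "\<alpha> t = (\<integral>\<^sup>+s. A (s, t) \<partial>lborel)" and "\<beta> s = (\<integral>\<^sup>+t. B (s, t) \<partial>lborel)" for t s
  have [measurable]: "\<alpha> \<in> borel_measurable borel" "\<beta> \<in> borel_measurable borel"
    unfolding \<alpha>_def[abs_def] \<beta>_def[abs_def] by measurable
  have "(\<integral>\<^sup>+z. (q z)\<^sup>2 \<partial>lborel) \<le> (\<integral>\<^sup>+z. \<alpha> (snd z) * \<beta> (fst z) \<partial>lborel)"
    using A B unfolding power2_eq_square \<alpha>_def \<beta>_def
    by (intro nn_integral_mono mult_mono) (auto simp: split_paired_all)
  also have "\<dots> = (\<integral>\<^sup>+s. \<integral>\<^sup>+t. \<alpha> t * \<beta> s \<partial>lborel \<partial>lborel)"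
    by (subst nn_integral_lborel_pair(1)) (simp_all flip: borel_prod)
  also have "\<dots> = (\<integral>\<^sup>+t. \<alpha> t \<partial>lborel) * (\<integral>\<^sup>+s. \<beta> s \<partial>lborel)"
    by (simp add: nn_integral_multc nn_integral_cmult)
  also have "\<dots> = (\<integral>\<^sup>+z. A z \<partial>lborel) * (\<integral>\<^sup>+z. B z \<partial>lborel)"
    unfolding \<alpha>_def \<beta>_def by (simp flip: nn_integral_lborel_pair(2)[of A] nn_integral_lborel_pair(1)[of B])
  finally show ?thesis .
qed

lemma abs_le_nn_integral_deriv:
  fixes g :: "real \<Rightarrow> real"
  assumes g: "\<And>s. (g has_real_derivative g' s) (at s)" and cont: "continuous_on UNIV g'"
    and "a \<le> t" "g a = 0"
  shows "ennreal \<bar>g t\<bar> \<le> (\<integral>\<^sup>+s. ennreal \<bar>g' s\<bar> \<partial>lborel)"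
proof -
  let ?h = "\<lambda>s. g' s * indicator {a..t} s"
  have isCont: "isCont g' s" for s using cont by (simp add: continuous_on_eq_continuous_at)
  have "integrable lborel ?h"
    using borel_integrable_atLeastAtMost[of a t g'] isCont by (simp add: mult.commute)
  moreover have "(LINT s|lborel. ?h s) = g t - g a"
    by (rule integral_FTC_Icc_real[OF \<open>a \<le> t\<close> g]) (rule isCont)
  ultimately have "ennreal \<bar>g t\<bar> \<le> (\<integral>\<^sup>+s. ennreal (norm (?h s)) \<partial>lborel)"
    using integral_norm_bound_ennreal[of lborel ?h] \<open>g a = 0\<close> by simp
  also have "\<dots> \<le> (\<integral>\<^sup>+s. ennreal \<bar>g' s\<bar> \<partial>lborel)"
    by (intro nn_integral_mono) (auto simp: indicator_def)
  finally show ?thesis .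
qed

lemma test_fun_abs_le_line_integral:
  assumes f: "test_fun \<Omega> f" and i: "i \<in> Basis"
  shows "ennreal \<bar>f (x + t *\<^sub>R i)\<bar> \<le> (\<integral>\<^sup>+s. ennreal \<bar>partial i f (x + s *\<^sub>R i)\<bar> \<partial>lborel)"
proof -
  obtain r where r: "r > 0" "\<And>x. norm x > r \<Longrightarrow> f x = 0"
    using test_fun_zero_outside_ball[OF f] by blast
  define a where "a = - (r + norm x + \<bar>t\<bar> + 1)"
  have "norm (x + a *\<^sub>R i) \<ge> norm (a *\<^sub>R i) - norm x"
    by (metis add.commute norm_diff_ineq)
  then have "norm (x + a *\<^sub>R i) > r"
    using i r(1) by (simp add: a_def)
  then have "f (x + a *\<^sub>R i) = 0" by (rule r(2))
  moreover have "a \<le> t"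
    unfolding a_def using r(1) norm_ge_zero[of x] by linarith
  moreover have "continuous_on UNIV (\<lambda>s. partial i f (x + s *\<^sub>R i))"
    using test_fun_continuous[OF test_fun_partial[OF f i]]
    by (rule continuous_on_compose2) (auto intro!: continuous_intros)
  ultimately show ?thesis
    by (intro abs_le_nn_integral_deriv[OF test_fun_line_derivative[OF f]])
qed

lemma planar_Gagliardo_Nirenberg:
  assumes g: "test_fun \<Omega> g" and ab: "a \<in> Basis" "b \<in> Basis"
  shows "(\<integral>\<^sup>+z. ennreal ((g (x + plane a b z))\<^sup>2) \<partial>lborel)
    \<le> (\<integral>\<^sup>+z. ennreal \<bar>partial a g (x + plane a b z)\<bar> \<partial>lborel)
      * (\<integral>\<^sup>+z. ennreal \<bar>partial b g (x + plane a b z)\<bar> \<partial>lborel)"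
proof -
  note [measurable] = test_fun_measurable[OF test_fun_partial[OF g ab(1)]]
    test_fun_measurable[OF test_fun_partial[OF g ab(2)]]
  have "(\<integral>\<^sup>+z. (ennreal \<bar>g (x + plane a b z)\<bar>)\<^sup>2 \<partial>lborel)
    \<le> (\<integral>\<^sup>+z. ennreal \<bar>partial a g (x + plane a b z)\<bar> \<partial>lborel)
      * (\<integral>\<^sup>+z. ennreal \<bar>partial b g (x + plane a b z)\<bar> \<partial>lborel)"
  proof (rule nn_integral_square_le_pair)
    show "ennreal \<bar>g (x + plane a b (s, t))\<bar> \<le> (\<integral>\<^sup>+s. ennreal \<bar>partial a g (x + plane a b (s, t))\<bar> \<partial>lborel)"
      for s t
      using test_fun_abs_le_line_integral[OF g ab(1), of "x + t *\<^sub>R b" s] by (simp add: plane_def add_ac)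
    show "ennreal \<bar>g (x + plane a b (s, t))\<bar> \<le> (\<integral>\<^sup>+t. ennreal \<bar>partial b g (x + plane a b (s, t))\<bar> \<partial>lborel)"
      for s t
      using test_fun_abs_le_line_integral[OF g ab(2), of "x + s *\<^sub>R a" t] by (simp add: plane_def add_ac)
  qed measurable
  then show ?thesis by (simp add: ennreal_power)
qed

lemma partial_test_fun_square:
  "test_fun \<Omega> f \<Longrightarrow> partial i (\<lambda>x. (f x)\<^sup>2) x = 2 * f x * partial i f x"
  using partial_test_fun_mult[of \<Omega> f f] by (simp add: power2_eq_square)

lemma test_fun_square: "test_fun \<Omega> f \<Longrightarrow> test_fun \<Omega> (\<lambda>x. (f x)\<^sup>2)"
  unfolding power2_eq_square by (rule test_fun_mult)

lemma ennreal_mult_le_squares: "a * b \<le> a\<^sup>2 + (b::ennreal)\<^sup>2"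
proof (cases "a \<le> b")
  case True
  then have "a * b \<le> b\<^sup>2" by (simp add: power2_eq_square mult_right_mono)
  then show ?thesis by (simp add: add_increasing)
next
  case False
  then have "a * b \<le> a\<^sup>2" by (simp add: power2_eq_square mult_left_mono)
  then show ?thesis by (simp add: add_increasing2)
qed

lemma nn_integral_partial_square_power2_le:
  assumes f: "test_fun \<Omega> f" and i: "i \<in> Basis" and h[measurable]: "h \<in> measurable M borel"
  shows "(\<integral>\<^sup>+z. ennreal \<bar>partial i (\<lambda>x. (f x)\<^sup>2) (h z)\<bar> \<partial>M)\<^sup>2
    \<le> 4 * (\<integral>\<^sup>+z. ennreal ((f (h z))\<^sup>2) \<partial>M) * (\<integral>\<^sup>+z. ennreal ((partial i f (h z))\<^sup>2) \<partial>M)"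
proof -
  note [measurable] = test_fun_measurable[OF f] test_fun_measurable[OF test_fun_partial[OF f i]]
  have "(\<integral>\<^sup>+z. ennreal \<bar>partial i (\<lambda>x. (f x)\<^sup>2) (h z)\<bar> \<partial>M)
      = (\<integral>\<^sup>+z. ennreal (2 * \<bar>f (h z)\<bar>) * ennreal \<bar>partial i f (h z)\<bar> \<partial>M)"
    by (simp add: partial_test_fun_square[OF f] abs_mult ennreal_mult)
  also have "(\<dots>)\<^sup>2 \<le> (\<integral>\<^sup>+z. (ennreal (2 * \<bar>f (h z)\<bar>))\<^sup>2 \<partial>M) * (\<integral>\<^sup>+z. (ennreal \<bar>partial i f (h z)\<bar>)\<^sup>2 \<partial>M)"
    by (intro Cauchy_Schwarz_nn_integral) measurable
  also have "\<dots> = 4 * (\<integral>\<^sup>+z. ennreal ((f (h z))\<^sup>2) \<partial>M) * (\<integral>\<^sup>+z. ennreal ((partial i f (h z))\<^sup>2) \<partial>M)"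
    by (simp add: ennreal_power power_mult_distrib ennreal_mult nn_integral_cmult)
  finally show ?thesis .
qed

lemma nn_integral_plane_le:
  fixes f :: "'a::euclidean_space \<Rightarrow> real"
  assumes B: "(Basis :: 'a set) = {a, b, c}" "a \<noteq> b" "a \<noteq> c" "b \<noteq> c" and f: "test_fun \<Omega> f"
  shows "(\<integral>\<^sup>+z. ennreal \<bar>f (r *\<^sub>R c + plane a b z)\<bar> \<partial>lborel) \<le> (\<integral>\<^sup>+x. ennreal \<bar>partial c f x\<bar> \<partial>lborel)"
proof -
  have c: "c \<in> Basis" unfolding B(1) by simp
  note [measurable] = test_fun_measurable[OF test_fun_partial[OF f c]]
  have "(\<integral>\<^sup>+z. ennreal \<bar>f (r *\<^sub>R c + plane a b z)\<bar> \<partial>lborel)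
      \<le> (\<integral>\<^sup>+z. \<integral>\<^sup>+r. ennreal \<bar>partial c f (r *\<^sub>R c + plane a b z)\<bar> \<partial>lborel \<partial>lborel)"
  proof (rule nn_integral_mono)
    show "ennreal \<bar>f (r *\<^sub>R c + plane a b z)\<bar>
        \<le> (\<integral>\<^sup>+r. ennreal \<bar>partial c f (r *\<^sub>R c + plane a b z)\<bar> \<partial>lborel)" for z
      using test_fun_abs_le_line_integral[OF f c, of "plane a b z" r] by (simp add: add.commute)
  qed
  also have "\<dots> = (\<integral>\<^sup>+r. \<integral>\<^sup>+z. ennreal \<bar>partial c f (r *\<^sub>R c + plane a b z)\<bar> \<partial>lborel \<partial>lborel)"
    by (intro lborel_pair.Fubini') measurable
  also have "\<dots> = (\<integral>\<^sup>+x. ennreal \<bar>partial c f x\<bar> \<partial>lborel)"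
    by (rule nn_integral_lborel_axis_plane[OF B, symmetric]) measurable
  finally show ?thesis .
qed

lemma Ladyzhenskaya_dim2:
  fixes f :: "'a::euclidean_space \<Rightarrow> real"
  assumes B: "(Basis :: 'a set) = {a, b}" "a \<noteq> b" and f: "test_fun \<Omega> f"
  shows "(\<integral>\<^sup>+x. ennreal ((f x)^4) \<partial>lborel)
    \<le> (\<integral>\<^sup>+x. ennreal \<bar>partial a (\<lambda>x. (f x)\<^sup>2) x\<bar> \<partial>lborel)
      * (\<integral>\<^sup>+x. ennreal \<bar>partial b (\<lambda>x. (f x)\<^sup>2) x\<bar> \<partial>lborel)"
proof -
  have ab: "a \<in> Basis" "b \<in> Basis" using B by auto
  note g = test_fun_square[OF f]
  note [measurable] = test_fun_measurable[OF f] test_fun_measurable[OF test_fun_partial[OF g ab(1)]]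
    test_fun_measurable[OF test_fun_partial[OF g ab(2)]]
  show ?thesis
    using planar_Gagliardo_Nirenberg[OF g ab, of 0] by (simp add: nn_integral_lborel_plane[OF B])
qed

text \<open>On each plane orthogonal to \<open>c\<close> the planar inequality and the Cauchy-Schwarz inequality bound
  \<open>\<integral>f\<^sup>4\<close> by a multiple of \<open>\<integral>f\<^sup>2\<close> times the sum of \<open>\<integral>|\<partial>\<^sub>a f|\<^sup>2\<close> and \<open>\<integral>|\<partial>\<^sub>b f|\<^sup>2\<close>; the factor \<open>\<integral>f\<^sup>2\<close> is bounded
  uniformly over the planes by integrating along \<open>c\<close>.\<close>
lemma Ladyzhenskaya_dim3:
  fixes f :: "'a::euclidean_space \<Rightarrow> real"
  assumes B: "(Basis :: 'a set) = {a, b, c}" "a \<noteq> b" "a \<noteq> c" "b \<noteq> c" and f: "test_fun \<Omega> f"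
  shows "(\<integral>\<^sup>+x. ennreal ((f x)^4) \<partial>lborel) \<le> 4 * (\<integral>\<^sup>+x. ennreal \<bar>partial c (\<lambda>x. (f x)\<^sup>2) x\<bar> \<partial>lborel)
    * ((\<integral>\<^sup>+x. ennreal ((partial a f x)\<^sup>2) \<partial>lborel) + (\<integral>\<^sup>+x. ennreal ((partial b f x)\<^sup>2) \<partial>lborel))"
proof -
  have ab: "a \<in> Basis" "b \<in> Basis" using B by auto
  note g = test_fun_square[OF f]
  note [measurable] = test_fun_measurable[OF f] test_fun_measurable[OF test_fun_partial[OF f ab(1)]]
    test_fun_measurable[OF test_fun_partial[OF f ab(2)]]
  define X where "X r z = r *\<^sub>R c + plane a b z" for r z
  have [measurable]: "X r \<in> borel_measurable borel"
    "(\<lambda>p. X (fst p) (snd p)) \<in> borel_measurable (borel \<Otimes>\<^sub>M borel)" for r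
    unfolding X_def[abs_def] by measurable
  note slices = nn_integral_lborel_axis_plane[OF B, folded X_def]
  define K where "K = (\<integral>\<^sup>+x. ennreal \<bar>partial c (\<lambda>x. (f x)\<^sup>2) x\<bar> \<partial>lborel)"
  define P where "P i r = (\<integral>\<^sup>+z. ennreal \<bar>partial i (\<lambda>x. (f x)\<^sup>2) (X r z)\<bar> \<partial>lborel)" for i r
  define D where "D i r = (\<integral>\<^sup>+z. ennreal ((partial i f (X r z))\<^sup>2) \<partial>lborel)" for i r
  have P_le: "(P i r)\<^sup>2 \<le> 4 * K * D i r" if "i \<in> Basis" for i r
  proof -
    have "(P i r)\<^sup>2 \<le> 4 * (\<integral>\<^sup>+z. ennreal ((f (X r z))\<^sup>2) \<partial>lborel) * D i r"
      unfolding P_def D_def by (intro nn_integral_partial_square_power2_le[OF f that]) simp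
    also have "\<dots> \<le> 4 * K * D i r"
      using nn_integral_plane_le[OF B g, of r]
      by (intro mult_right_mono mult_left_mono) (simp_all add: K_def X_def)
    finally show ?thesis .
  qed
  have "(\<integral>\<^sup>+x. ennreal ((f x)^4) \<partial>lborel) = (\<integral>\<^sup>+r. \<integral>\<^sup>+z. ennreal (((f (X r z))\<^sup>2)\<^sup>2) \<partial>lborel \<partial>lborel)"
    by (subst slices) simp_all
  also have "\<dots> \<le> (\<integral>\<^sup>+r. P a r * P b r \<partial>lborel)"
    unfolding P_def X_def by (intro nn_integral_mono planar_Gagliardo_Nirenberg[OF g ab])
  also have "\<dots> \<le> (\<integral>\<^sup>+r. 4 * K * D a r + 4 * K * D b r \<partial>lborel)"
    by (intro nn_integral_mono order_trans[OF ennreal_mult_le_squares] add_mono P_le ab)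
  also have "\<dots> = 4 * K * ((\<integral>\<^sup>+r. D a r \<partial>lborel) + (\<integral>\<^sup>+r. D b r \<partial>lborel))"
    unfolding D_def by (simp add: nn_integral_add nn_integral_cmult distrib_left)
  finally show ?thesis
    by (simp add: D_def K_def slices)
qed

lemma ennreal_abs_two_mult_le: "ennreal \<bar>2 * x * y\<bar> \<le> ennreal (x\<^sup>2) + ennreal (y\<^sup>2)"
  using sum_squares_bound[of "\<bar>x\<bar>" "\<bar>y\<bar>"] by (simp flip: ennreal_plus add: ennreal_leI abs_mult)

lemma Ladyzhenskaya:
  fixes f :: "'a::euclidean_space \<Rightarrow> real"
  assumes dim: "DIM('a) = 2 \<or> DIM('a) = 3" and f: "test_fun \<Omega> f"
  shows "(\<integral>\<^sup>+x. ennreal ((f x)^4) \<partial>lborel)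
    \<le> 4 * ((\<integral>\<^sup>+x. ennreal ((f x)\<^sup>2) \<partial>lborel) + (\<Sum>i\<in>Basis. \<integral>\<^sup>+x. ennreal ((partial i f x)\<^sup>2) \<partial>lborel))\<^sup>2"
    (is "_ \<le> 4 * ?Q\<^sup>2")
proof -
  have partial_le: "(\<integral>\<^sup>+x. ennreal \<bar>partial i (\<lambda>x. (f x)\<^sup>2) x\<bar> \<partial>lborel) \<le> ?Q" if "i \<in> Basis" for i
  proof -
    note [measurable] = test_fun_measurable[OF f] test_fun_measurable[OF test_fun_partial[OF f that]]
    have "(\<integral>\<^sup>+x. ennreal \<bar>partial i (\<lambda>x. (f x)\<^sup>2) x\<bar> \<partial>lborel)
        \<le> (\<integral>\<^sup>+x. ennreal ((f x)\<^sup>2) + ennreal ((partial i f x)\<^sup>2) \<partial>lborel)"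
      unfolding partial_test_fun_square[OF f] by (intro nn_integral_mono ennreal_abs_two_mult_le)
    also have "\<dots> = (\<integral>\<^sup>+x. ennreal ((f x)\<^sup>2) \<partial>lborel) + (\<integral>\<^sup>+x. ennreal ((partial i f x)\<^sup>2) \<partial>lborel)"
      by (rule nn_integral_add) measurable
    also have "\<dots> \<le> ?Q"
      using that by (intro add_left_mono member_le_sum) auto
    finally show ?thesis .
  qed
  from dim show ?thesis
  proof
    assume "DIM('a) = 2"
    then obtain a b where B: "(Basis :: 'a set) = {a, b}" "a \<noteq> b"
      by (auto simp: card_2_iff)
    have "(\<integral>\<^sup>+x. ennreal ((f x)^4) \<partial>lborel) \<le> ?Q * ?Q"
      using B by (intro order_trans[OF Ladyzhenskaya_dim2[OF B f]] mult_mono partial_le) auto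
    also have "\<dots> \<le> 4 * ?Q\<^sup>2"
      using mult_right_mono[of 1 "4::ennreal" "?Q\<^sup>2"] by (simp add: power2_eq_square)
    finally show ?thesis .
  next
    assume "DIM('a) = 3"
    then obtain a b c where B: "(Basis :: 'a set) = {a, b, c}" "a \<noteq> b" "a \<noteq> c" "b \<noteq> c"
      by (auto simp: card_3_iff)
    have "(\<integral>\<^sup>+x. ennreal ((partial a f x)\<^sup>2) \<partial>lborel) + (\<integral>\<^sup>+x. ennreal ((partial b f x)\<^sup>2) \<partial>lborel) \<le> ?Q"
      using B(2-4) by (simp add: B(1) add_increasing add_increasing2 add.assoc[symmetric])
    then have "(\<integral>\<^sup>+x. ennreal ((f x)^4) \<partial>lborel) \<le> 4 * ?Q * ?Q"
      using B by (intro order_trans[OF Ladyzhenskaya_dim3[OF B f]] mult_mono partial_le) auto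
    then show ?thesis by (simp only: power2_eq_square mult.assoc)
  qed
qed

context lebesgue_domain
begin

lemma test_fun_nn_integral_square:
  assumes f: "test_fun \<Omega> f"
  shows "(\<integral>\<^sup>+x. ennreal ((f x)\<^sup>2) \<partial>lborel) = ennreal (LINT x|lebesgue_on \<Omega>. (f x)\<^sup>2)"
  using test_fun_square[OF f]
  by (simp add: nn_integral_eq_integral test_fun_integrable_lborel test_fun_integral_lborel)

lemma test_fun_L4_le:
  assumes dim: "DIM('a) = 2 \<or> DIM('a) = 3" and f: "test_fun \<Omega> f"
  shows "(\<integral>\<^sup>+x. ennreal ((f x)^4) \<partial>lebesgue_on \<Omega>) \<le> ennreal (4 * ((LINT x|lebesgue_on \<Omega>. (f x)\<^sup>2)
    + (\<Sum>i\<in>Basis. LINT x|lebesgue_on \<Omega>. (partial i f x)\<^sup>2))\<^sup>2)"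
proof -
  have [measurable]: "f \<in> borel_measurable borel" by (rule test_fun_measurable[OF f])
  have "(\<integral>\<^sup>+x. ennreal ((f x)^4) \<partial>lebesgue_on \<Omega>) = (\<integral>\<^sup>+x. ennreal ((f x)^4) * indicator \<Omega> x \<partial>lebesgue)"
    using sets_lebesgue by (subst nn_integral_restrict_space) auto
  also have "\<dots> \<le> (\<integral>\<^sup>+x. ennreal ((f x)^4) \<partial>lebesgue)"
    by (intro nn_integral_mono) (auto simp: indicator_def)
  also have "\<dots> = (\<integral>\<^sup>+x. ennreal ((f x)^4) \<partial>lborel)"
    by (simp add: nn_integral_completion)
  also note Ladyzhenskaya[OF dim f]
  finally show ?thesis
    by (simp add: test_fun_nn_integral_square[OF f] test_fun_nn_integral_square[OF test_fun_partial[OF f]]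
        sum_ennreal sum_nonneg ennreal_power ennreal_mult flip: ennreal_plus)
qed

lemma scalar_H10_L4:
  assumes dim: "DIM('a) = 2 \<or> DIM('a) = 3" and f: "scalar_H10 \<Omega> f g"
  shows "L2 \<Omega> (\<lambda>x. (f x)\<^sup>2)"
proof -
  let ?M = "lebesgue_on \<Omega>"
  obtain \<psi> where \<psi>: "\<And>n. test_fun \<Omega> (\<psi> n)" "L2_tendsto \<Omega> \<psi> f"
    "\<And>i. i \<in> Basis \<Longrightarrow> L2_tendsto \<Omega> (\<lambda>n. partial i (\<psi> n)) (\<lambda>x. g x i)"
    "AE x in ?M. (\<lambda>n. \<psi> n x) \<longlonglongrightarrow> f x"
    using scalar_H10_AE_E[OF f] by blast
  note [measurable] = L2_tendstoD(1,2)[OF \<psi>(2), THEN L2_measurable]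
  define Q where "Q n = (LINT x|?M. (\<psi> n x)\<^sup>2) + (\<Sum>i\<in>Basis. LINT x|?M. (partial i (\<psi> n) x)\<^sup>2)" for n
  define q where "q = (LINT x|?M. (f x)\<^sup>2) + (\<Sum>i\<in>Basis. LINT x|?M. (g x i)\<^sup>2)"
  have "Q \<longlonglongrightarrow> q"
    unfolding Q_def q_def by (intro tendsto_add tendsto_sum L2_tendsto_integral_square \<psi>)
  then have bound: "(\<lambda>n. ennreal (4 * (Q n)\<^sup>2)) \<longlonglongrightarrow> ennreal (4 * q\<^sup>2)"
    by (intro tendsto_intros)
  have "(\<integral>\<^sup>+x. ennreal ((f x)^4) \<partial>?M) = (\<integral>\<^sup>+x. liminf (\<lambda>n. ennreal ((\<psi> n x)^4)) \<partial>?M)"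
    using \<psi>(4)
    by (intro nn_integral_cong_AE)
       (auto elim!: eventually_mono intro!: lim_imp_Liminf[symmetric] tendsto_ennrealI tendsto_power)
  also have "\<dots> \<le> liminf (\<lambda>n. \<integral>\<^sup>+x. ennreal ((\<psi> n x)^4) \<partial>?M)"
    by (rule nn_integral_liminf) simp
  also have "\<dots> \<le> liminf (\<lambda>n. ennreal (4 * (Q n)\<^sup>2))"
    unfolding Q_def by (intro Liminf_mono always_eventually allI test_fun_L4_le dim \<psi>(1))
  also have "\<dots> = ennreal (4 * q\<^sup>2)"
    by (rule lim_imp_Liminf[OF _ bound]) simp
  finally have "integrable ?M (\<lambda>x. (f x)^4)"
    by (intro integrableI_nonneg) (auto simp: le_less_trans)
  then show ?thesis unfolding L2_def by (simp flip: power_mult)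
qed

end

section \<open>Vector fields\<close>

lemma partial_inner:
  assumes "test_vfun \<Omega> \<phi>" "j \<in> Basis"
  shows "partial i \<phi> x \<bullet> j = partial i (\<lambda>x. \<phi> x \<bullet> j) x"
proof -
  have "\<phi> differentiable (at x)"
    using assms(1) unfolding test_vfun_def differentiable_componentwise_within[of \<phi>]
    by (blast intro: differentiableI test_fun_has_derivative)
  then have "(\<phi> has_derivative frechet_derivative \<phi> (at x)) (at x)"
    by (simp add: frechet_derivative_works)
  from frechet_derivative_at[OF has_derivative_inner_left[OF this, of j]]
  show ?thesis by metis
qed

lemma H10_imp_H1: "H10 \<Omega> u Du \<Longrightarrow> H1 \<Omega> u Du"
  by (simp add: H10_def)

lemma H1_L2v: "H1 \<Omega> u Du \<Longrightarrow> L2v \<Omega> u"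
  and H1_grad_L2v: "H1 \<Omega> u Du \<Longrightarrow> i \<in> Basis \<Longrightarrow> L2v \<Omega> (\<lambda>x. Du x i)"
  and H1_weak_partial: "H1 \<Omega> u Du \<Longrightarrow> i \<in> Basis \<Longrightarrow> j \<in> Basis \<Longrightarrow>
    weak_partial \<Omega> i (\<lambda>x. u x \<bullet> j) (\<lambda>x. Du x i \<bullet> j)"
  by (simp_all add: H1_def weak_grad_iff_components)

definition grad_tendsto ::
  "'a::euclidean_space set \<Rightarrow> (nat \<Rightarrow> 'a \<Rightarrow> 'a \<Rightarrow> 'a) \<Rightarrow> ('a \<Rightarrow> 'a \<Rightarrow> 'a) \<Rightarrow> bool" where
  "grad_tendsto \<Omega> Dv Du \<longleftrightarrow> (\<forall>i\<in>Basis. L2v_tendsto \<Omega> (\<lambda>n x. Dv n x i) (\<lambda>x. Du x i))"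

lemma grad_tendsto_iff:
  assumes Dv: "\<And>n i. i \<in> Basis \<Longrightarrow> L2v \<Omega> (\<lambda>x. Dv n x i)" and Du: "\<And>i. i \<in> Basis \<Longrightarrow> L2v \<Omega> (\<lambda>x. Du x i)"
  shows "grad_tendsto \<Omega> Dv Du \<longleftrightarrow>
    (\<lambda>n. LINT x|lebesgue_on \<Omega>. (\<Sum>i\<in>Basis. (norm (Dv n x i - Du x i))\<^sup>2)) \<longlonglongrightarrow> 0"
proof -
  have "(LINT x|lebesgue_on \<Omega>. (\<Sum>i\<in>Basis. (norm (Dv n x i - Du x i))\<^sup>2))
      = (\<Sum>i\<in>Basis. LINT x|lebesgue_on \<Omega>. (norm (Dv n x i - Du x i))\<^sup>2)" for n
    by (intro Bochner_Integration.integral_sum L2v_norm_square_integrable L2v_diff Dv Du)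
  with assms show ?thesis
    by (simp add: grad_tendsto_def L2v_tendsto_def tendsto_sum_nonneg_zero_iff)
qed

lemma grad_sq_integrable: "H1 \<Omega> u Du \<Longrightarrow> integrable (lebesgue_on \<Omega>) (grad_sq Du)"
  unfolding grad_sq_def[abs_def]
  by (intro Bochner_Integration.integrable_sum L2v_norm_square_integrable H1_grad_L2v)

lemma
  assumes "H1 \<Omega> u Du" "H1 \<Omega> v Dv"
  shows grad_inner_integrable: "integrable (lebesgue_on \<Omega>) (grad_inner Du Dv)"
    and grad_inner_integral: "(LINT x|lebesgue_on \<Omega>. grad_inner Du Dv x)
      = (\<Sum>i\<in>Basis. LINT x|lebesgue_on \<Omega>. Du x i \<bullet> Dv x i)"
  unfolding grad_inner_def[abs_def]
  by (intro Bochner_Integration.integrable_sum Bochner_Integration.integral_sum L2v_inner_integrable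
      H1_grad_L2v[OF assms(1)] H1_grad_L2v[OF assms(2)]; assumption)+

lemma grad_inner_self: "grad_inner Du Du = grad_sq Du"
  by (simp add: grad_inner_def[abs_def] grad_sq_def[abs_def] power2_norm_eq_inner)

lemma divg_L2: "H1 \<Omega> u Du \<Longrightarrow> L2 \<Omega> (divg Du)"
  unfolding divg_def[abs_def] by (intro L2_sum L2v_component H1_grad_L2v)

lemma L2_tendsto_divg: "grad_tendsto \<Omega> Dv Du \<Longrightarrow> L2_tendsto \<Omega> (\<lambda>n. divg (Dv n)) (divg Du)"
  unfolding divg_def[abs_def] grad_tendsto_def by (intro L2_tendsto_sum L2v_tendsto_component) simp_all

context lebesgue_domain
begin

lemma test_vfun_L2v: "test_vfun \<Omega> \<phi> \<Longrightarrow> L2v \<Omega> \<phi>"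
  by (simp add: L2v_iff_components test_vfun_def test_fun_L2)

lemma test_vfun_partial_L2v: "test_vfun \<Omega> \<phi> \<Longrightarrow> i \<in> Basis \<Longrightarrow> L2v \<Omega> (partial i \<phi>)"
  by (simp add: L2v_iff_components partial_inner)
     (simp add: test_vfun_def test_fun_L2 test_fun_partial)

lemma H10_iff_approx:
  "H10 \<Omega> u Du \<longleftrightarrow> weak_grad \<Omega> u Du \<and> (\<exists>\<phi>. (\<forall>n. test_vfun \<Omega> (\<phi> n)) \<and> L2v_tendsto \<Omega> \<phi> u \<and>
     grad_tendsto \<Omega> (\<lambda>n x i. partial i (\<phi> n) x) Du)"
proof
  assume u: "H10 \<Omega> u Du"
  then obtain \<phi> where \<phi>: "\<And>n. test_vfun \<Omega> (\<phi> n)"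
    "(\<lambda>n. LINT x|lebesgue_on \<Omega>. (norm (\<phi> n x - u x))\<^sup>2) \<longlonglongrightarrow> 0"
    "(\<lambda>n. LINT x|lebesgue_on \<Omega>. (\<Sum>i\<in>Basis. (norm (partial i (\<phi> n) x - Du x i))\<^sup>2)) \<longlonglongrightarrow> 0"
    unfolding H10_def by blast
  have "L2v_tendsto \<Omega> \<phi> u"
    using \<phi> H1_L2v[OF H10_imp_H1[OF u]] by (simp add: L2v_tendsto_def test_vfun_L2v)
  moreover have "grad_tendsto \<Omega> (\<lambda>n x i. partial i (\<phi> n) x) Du"
    using \<phi> H1_grad_L2v[OF H10_imp_H1[OF u]] by (subst grad_tendsto_iff) (simp_all add: test_vfun_partial_L2v)
  ultimately show "weak_grad \<Omega> u Du \<and> (\<exists>\<phi>. (\<forall>n. test_vfun \<Omega> (\<phi> n)) \<and> L2v_tendsto \<Omega> \<phi> u \<and>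
      grad_tendsto \<Omega> (\<lambda>n x i. partial i (\<phi> n) x) Du)"
    using u \<phi>(1) by (auto simp: H10_def H1_def)
next
  assume "weak_grad \<Omega> u Du \<and> (\<exists>\<phi>. (\<forall>n. test_vfun \<Omega> (\<phi> n)) \<and> L2v_tendsto \<Omega> \<phi> u \<and>
     grad_tendsto \<Omega> (\<lambda>n x i. partial i (\<phi> n) x) Du)"
  then obtain \<phi> where weak: "weak_grad \<Omega> u Du" and \<phi>: "\<And>n. test_vfun \<Omega> (\<phi> n)" "L2v_tendsto \<Omega> \<phi> u"
    "grad_tendsto \<Omega> (\<lambda>n x i. partial i (\<phi> n) x) Du"
    by blast
  have Du: "L2v \<Omega> (\<lambda>x. Du x i)" if "i \<in> Basis" for i
    using \<phi>(3) that by (auto simp: grad_tendsto_def L2v_tendsto_def)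
  have "(\<lambda>n. LINT x|lebesgue_on \<Omega>. (\<Sum>i\<in>Basis. (norm (partial i (\<phi> n) x - Du x i))\<^sup>2)) \<longlonglongrightarrow> 0"
    using \<phi> Du by (subst (asm) grad_tendsto_iff) (simp_all add: test_vfun_partial_L2v)
  with weak \<phi> Du show "H10 \<Omega> u Du"
    unfolding H10_def H1_def L2v_tendsto_def by blast
qed

lemma H10_component:
  assumes u: "H10 \<Omega> u Du" and j: "j \<in> Basis"
  shows "scalar_H10 \<Omega> (\<lambda>x. u x \<bullet> j) (\<lambda>x i. Du x i \<bullet> j)"
proof -
  obtain \<phi> where \<phi>: "\<And>n. test_vfun \<Omega> (\<phi> n)" "L2v_tendsto \<Omega> \<phi> u"
    "grad_tendsto \<Omega> (\<lambda>n x i. partial i (\<phi> n) x) Du"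
    using u unfolding H10_iff_approx by blast
  have "L2_tendsto \<Omega> (\<lambda>n. partial i (\<lambda>x. \<phi> n x \<bullet> j)) (\<lambda>x. Du x i \<bullet> j)" if "i \<in> Basis" for i
    using \<phi>(3) that j
    by (simp add: grad_tendsto_def L2v_tendsto_component flip: partial_inner[OF \<phi>(1) j])
  moreover have "test_fun \<Omega> (\<lambda>x. \<phi> n x \<bullet> j)" for n
    using \<phi>(1) j by (simp add: test_vfun_def)
  moreover have "L2_tendsto \<Omega> (\<lambda>n x. \<phi> n x \<bullet> j) (\<lambda>x. u x \<bullet> j)"
    by (rule L2v_tendsto_component[OF \<phi>(2) j])
  ultimately show ?thesis
    unfolding scalar_H10_def by (intro exI[where x = "\<lambda>n x. \<phi> n x \<bullet> j"]) simp
qed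

lemma H10_componentI:
  assumes u: "\<And>j. j \<in> Basis \<Longrightarrow> scalar_H10 \<Omega> (\<lambda>x. u x \<bullet> j) (\<lambda>x i. Du x i \<bullet> j)"
  shows "H10 \<Omega> u Du"
proof -
  have "\<forall>j\<in>Basis. \<exists>\<psi>. (\<forall>n. test_fun \<Omega> (\<psi> n)) \<and> L2_tendsto \<Omega> \<psi> (\<lambda>x. u x \<bullet> j) \<and>
      (\<forall>i\<in>Basis. L2_tendsto \<Omega> (\<lambda>n. partial i (\<psi> n)) (\<lambda>x. Du x i \<bullet> j))"
    using u by (simp add: scalar_H10_def)
  from bchoice[OF this] obtain \<psi> where \<psi>: "\<And>j n. j \<in> Basis \<Longrightarrow> test_fun \<Omega> (\<psi> j n)"
    "\<And>j. j \<in> Basis \<Longrightarrow> L2_tendsto \<Omega> (\<psi> j) (\<lambda>x. u x \<bullet> j)"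
    "\<And>i j. i \<in> Basis \<Longrightarrow> j \<in> Basis \<Longrightarrow> L2_tendsto \<Omega> (\<lambda>n. partial i (\<psi> j n)) (\<lambda>x. Du x i \<bullet> j)"
    by blast
  define \<phi> where "\<phi> n x = (\<Sum>j\<in>Basis. \<psi> j n x *\<^sub>R j)" for n x
  have component: "\<phi> n x \<bullet> j = \<psi> j n x" if "j \<in> Basis" for n x j
    using that by (simp add: \<phi>_def)
  have test: "test_vfun \<Omega> (\<phi> n)" for n
    using \<psi>(1) by (simp add: test_vfun_def component)
  have "partial i (\<phi> n) x \<bullet> j = partial i (\<psi> j n) x" if "j \<in> Basis" for n x i j
    using partial_inner[OF test that] by (simp add: component[OF that])
  then have "grad_tendsto \<Omega> (\<lambda>n x i. partial i (\<phi> n) x) Du"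
    by (simp add: grad_tendsto_def L2v_tendsto_iff_components \<psi>(3))
  moreover have "L2v_tendsto \<Omega> \<phi> u"
    by (simp add: L2v_tendsto_iff_components component \<psi>(2))
  moreover have "weak_grad \<Omega> u Du"
    using u by (auto simp: weak_grad_iff_components intro: scalar_H10_weak_partial)
  ultimately show ?thesis
    using test unfolding H10_iff_approx by blast
qed

lemma H10_iff_components:
  "H10 \<Omega> u Du \<longleftrightarrow> (\<forall>j\<in>Basis. scalar_H10 \<Omega> (\<lambda>x. u x \<bullet> j) (\<lambda>x i. Du x i \<bullet> j))"
  using H10_component H10_componentI by blast

lemma H1_lincomb:
  assumes "H1 \<Omega> u Du" "H1 \<Omega> v Dv"
  shows "H1 \<Omega> (\<lambda>x. a *\<^sub>R u x + b *\<^sub>R v x) (\<lambda>x i. a *\<^sub>R Du x i + b *\<^sub>R Dv x i)"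
  using assms
  by (auto simp: H1_def L2v_lincomb weak_grad_iff_components inner_add_left L2v_component
      intro!: weak_partial_lincomb)

lemma H10_lincomb:
  assumes "H10 \<Omega> u Du" "H10 \<Omega> v Dv"
  shows "H10 \<Omega> (\<lambda>x. a *\<^sub>R u x + b *\<^sub>R v x) (\<lambda>x i. a *\<^sub>R Du x i + b *\<^sub>R Dv x i)"
  using assms by (simp add: H10_iff_components inner_add_left scalar_H10_lincomb)

lemma H10_Ladyzhenskaya:
  assumes "DIM('a) = 2 \<or> DIM('a) = 3" "H10 \<Omega> u Du" "j \<in> Basis"
  shows "L2 \<Omega> (\<lambda>x. (u x \<bullet> j)\<^sup>2)"
  using assms scalar_H10_L4 by (auto simp: H10_iff_components)

end

section \<open>Componentwise composition and the convection term\<close>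

definition componentwise :: "(real \<Rightarrow> real) \<Rightarrow> 'a::euclidean_space \<Rightarrow> 'a" where
  "componentwise G y = (\<Sum>j\<in>Basis. G (y \<bullet> j) *\<^sub>R j)"

definition componentwise_grad ::
  "(real \<Rightarrow> real) \<Rightarrow> ('a::euclidean_space \<Rightarrow> 'a) \<Rightarrow> ('a \<Rightarrow> 'a \<Rightarrow> 'a) \<Rightarrow> 'a \<Rightarrow> 'a \<Rightarrow> 'a" where
  "componentwise_grad G' u Du x i = (\<Sum>j\<in>Basis. (G' (u x \<bullet> j) * (Du x i \<bullet> j)) *\<^sub>R j)"

lemma componentwise_inner [simp]: "j \<in> Basis \<Longrightarrow> componentwise G y \<bullet> j = G (y \<bullet> j)"
  by (simp add: componentwise_def)

lemma componentwise_grad_inner [simp]: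
  "j \<in> Basis \<Longrightarrow> componentwise_grad G' u Du x i \<bullet> j = G' (u x \<bullet> j) * (Du x i \<bullet> j)"
  by (simp add: componentwise_grad_def)

lemma inner_componentwise: "y \<bullet> componentwise G y = (\<Sum>j\<in>Basis. (y \<bullet> j) * G (y \<bullet> j))"
  by (simp add: euclidean_inner[of y "componentwise G y"])

context lebesgue_domain
begin

context
  fixes G G' :: "real \<Rightarrow> real" and B :: real
  assumes smooth: "smooth_fun G" and zero: "G 0 = 0"
    and deriv: "\<And>s. (G has_real_derivative G' s) (at s)" and bound: "\<And>s. \<bar>G' s\<bar> \<le> B"
begin

lemma H10_component_compose:
  assumes "H10 \<Omega> u Du" "j \<in> Basis"
  shows "scalar_H10 \<Omega> (\<lambda>x. G (u x \<bullet> j)) (\<lambda>x i. G' (u x \<bullet> j) * (Du x i \<bullet> j))"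
  using assms scalar_H10_compose[OF _ smooth zero deriv bound] by (simp add: H10_iff_components)

lemma H10_componentwise:
  assumes "H10 \<Omega> u Du"
  shows "H10 \<Omega> (\<lambda>x. componentwise G (u x)) (componentwise_grad G' u Du)"
  unfolding H10_iff_components using H10_component_compose[OF assms] by simp

text \<open>Since \<open>G'(u\<^sub>j) \<nabla>u\<^sub>j = \<nabla>G(u\<^sub>j)\<close>, this is an integration by parts.\<close>
lemma
  assumes w: "H1 \<Omega> w Dw" and u: "H10 \<Omega> u Du"
  shows convect_componentwise_integrable:
      "integrable (lebesgue_on \<Omega>) (\<lambda>x. convect w Du x \<bullet> componentwise G' (u x))"
    and convect_componentwise_integral:
      "(LINT x|lebesgue_on \<Omega>. convect w Du x \<bullet> componentwise G' (u x))
        = - (LINT x|lebesgue_on \<Omega>. (\<Sum>j\<in>Basis. G (u x \<bullet> j)) * divg Dw x)"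
proof -
  let ?M = "lebesgue_on \<Omega>"
  note G_u = H10_component_compose[OF u]
  have expand: "convect w Du x \<bullet> componentwise G' (u x)
      = (\<Sum>j\<in>Basis. \<Sum>i\<in>Basis. (w x \<bullet> i) * (G' (u x \<bullet> j) * (Du x i \<bullet> j)))" for x
    by (simp add: convect_def componentwise_def inner_sum_left inner_sum_right sum_distrib_left mult_ac)
  have w_L2: "L2 \<Omega> (\<lambda>x. w x \<bullet> i)" and Dw_L2: "L2 \<Omega> (\<lambda>x. Dw x i \<bullet> i)" if "i \<in> Basis" for i
    by (intro L2v_component H1_L2v[OF w] H1_grad_L2v[OF w] that)+
  have integrable: "integrable ?M (\<lambda>x. (w x \<bullet> i) * (G' (u x \<bullet> j) * (Du x i \<bullet> j)))"
    if "i \<in> Basis" "j \<in> Basis" for i j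
    by (intro L2_mult_integrable w_L2 scalar_H10_grad_L2[OF G_u] that)
  then show "integrable ?M (\<lambda>x. convect w Du x \<bullet> componentwise G' (u x))"
    unfolding expand by (intro Bochner_Integration.integrable_sum)
  have "(LINT x|?M. convect w Du x \<bullet> componentwise G' (u x))
      = (\<Sum>j\<in>Basis. \<Sum>i\<in>Basis. LINT x|?M. (w x \<bullet> i) * (G' (u x \<bullet> j) * (Du x i \<bullet> j)))"
    unfolding expand by (simp add: integrable)
  also have "\<dots> = (\<Sum>j\<in>Basis. \<Sum>i\<in>Basis. - (LINT x|?M. (Dw x i \<bullet> i) * G (u x \<bullet> j)))"
    by (intro sum.cong refl scalar_H10_integration_by_parts[OF G_u] H1_weak_partial[OF w] w_L2 Dw_L2)
  also have "\<dots> = - (\<Sum>j\<in>Basis. \<Sum>i\<in>Basis. LINT x|?M. (Dw x i \<bullet> i) * G (u x \<bullet> j))"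
    by (simp add: sum_negf)
  also have "(\<Sum>j\<in>Basis. \<Sum>i\<in>Basis. LINT x|?M. (Dw x i \<bullet> i) * G (u x \<bullet> j))
      = (LINT x|?M. (\<Sum>j\<in>Basis. \<Sum>i\<in>Basis. (Dw x i \<bullet> i) * G (u x \<bullet> j)))"
    by (simp add: L2_mult_integrable Dw_L2 scalar_H10_L2[OF G_u])
  also have "\<dots> = (LINT x|?M. (\<Sum>j\<in>Basis. G (u x \<bullet> j)) * divg Dw x)"
    by (simp add: divg_def sum_product mult.commute)
  finally show "(LINT x|?M. convect w Du x \<bullet> componentwise G' (u x))
      = - (LINT x|?M. (\<Sum>j\<in>Basis. G (u x \<bullet> j)) * divg Dw x)" .
qed

end

end

section \<open>Truncation\<close>

text \<open>\<open>T\<^sub>\<delta>\<close>, its primitive \<open>S\<^sub>\<delta>\<close> and its derivative for \<open>\<delta> = 1/(n+1)\<close>.\<close>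
definition sin_trunc :: "nat \<Rightarrow> real \<Rightarrow> real" where
  "sin_trunc n s = real (Suc n) * sin (1 / real (Suc n) * s)"

definition sin_trunc_prim :: "nat \<Rightarrow> real \<Rightarrow> real" where
  "sin_trunc_prim n s = (real (Suc n))\<^sup>2 * (1 - cos (1 / real (Suc n) * s))"

definition sin_trunc_deriv :: "nat \<Rightarrow> real \<Rightarrow> real" where
  "sin_trunc_deriv n s = cos (1 / real (Suc n) * s)"

lemma sin_trunc_zero: "sin_trunc n 0 = 0" and sin_trunc_prim_zero: "sin_trunc_prim n 0 = 0"
  by (simp_all add: sin_trunc_def sin_trunc_prim_def)

lemma sin_trunc_has_derivative: "(sin_trunc n has_real_derivative sin_trunc_deriv n s) (at s)"
  unfolding sin_trunc_def[abs_def] sin_trunc_deriv_def by (auto intro!: derivative_eq_intros)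

lemma sin_trunc_prim_has_derivative: "(sin_trunc_prim n has_real_derivative sin_trunc n s) (at s)"
  unfolding sin_trunc_prim_def[abs_def] sin_trunc_def
  by (auto intro!: derivative_eq_intros simp: power2_eq_square simp del: of_nat_Suc)

lemma smooth_fun_sin_trunc: "smooth_fun (sin_trunc n)"
  using smooth_fun_trig[of "real (Suc n)" "1 / real (Suc n)" 0 0] by (simp add: sin_trunc_def[abs_def])

lemma smooth_fun_sin_trunc_prim: "smooth_fun (sin_trunc_prim n)"
  using smooth_fun_trig[of 0 "1 / real (Suc n)" "- (real (Suc n))\<^sup>2" "(real (Suc n))\<^sup>2"]
  by (simp add: sin_trunc_prim_def[abs_def] right_diff_distrib)

lemma sin_trunc_measurable [measurable]:
  "sin_trunc n \<in> borel_measurable borel" "sin_trunc_prim n \<in> borel_measurable borel"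
  "sin_trunc_deriv n \<in> borel_measurable borel"
  unfolding sin_trunc_def[abs_def] sin_trunc_prim_def[abs_def] sin_trunc_deriv_def[abs_def] by measurable

lemma abs_sin_trunc_deriv_le: "\<bar>sin_trunc_deriv n s\<bar> \<le> 1"
  by (simp add: sin_trunc_deriv_def)

lemma abs_sin_trunc_bounded: "\<bar>sin_trunc n s\<bar> \<le> real (Suc n)"
  unfolding sin_trunc_def abs_mult using abs_sin_le_one[of "1 / real (Suc n) * s"]
  by (simp add: mult_le_cancel_left1)

lemma abs_sin_trunc_le: "\<bar>sin_trunc n s\<bar> \<le> \<bar>s\<bar>"
proof -
  have "\<bar>sin_trunc n s\<bar> \<le> real (Suc n) * \<bar>1 / real (Suc n) * s\<bar>"
    unfolding sin_trunc_def abs_mult[of "real (Suc n)"] abs_of_nat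
    by (intro mult_left_mono abs_sin_x_le_abs_x) simp
  then show ?thesis by simp
qed

lemma sin_trunc_prim_eq: "sin_trunc_prim n s = 2 * (sin_trunc n (s / 2))\<^sup>2"
  using cos_double_sin[of "1 / real (Suc n) * (s / 2)"]
  by (simp add: sin_trunc_prim_def sin_trunc_def power_mult_distrib del: of_nat_Suc)

lemma abs_sin_trunc_prim_le: "\<bar>sin_trunc_prim n s\<bar> \<le> \<bar>1 / 2 * s\<^sup>2\<bar>"
proof -
  have "(sin_trunc n (s / 2))\<^sup>2 \<le> (s / 2)\<^sup>2"
    using abs_sin_trunc_le by (simp add: abs_le_square_iff[symmetric] del: abs_divide)
  then show ?thesis unfolding sin_trunc_prim_eq by (simp add: power_divide)
qed

lemma sin_trunc_tendsto: "(\<lambda>n. sin_trunc n s) \<longlonglongrightarrow> s"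
proof -
  have "((\<lambda>h. sin (h * s)) has_real_derivative s) (at 0)"
    by (auto intro!: derivative_eq_intros)
  then have "((\<lambda>h. sin (h * s) / h) \<longlongrightarrow> s) (at 0)" by (simp add: DERIV_def)
  from filterlim_compose[OF this filterlim_inverse_Suc] show ?thesis
    by (simp add: sin_trunc_def mult.commute)
qed

lemma sin_trunc_prim_tendsto: "(\<lambda>n. sin_trunc_prim n s) \<longlonglongrightarrow> 1 / 2 * s\<^sup>2"
proof -
  have "(\<lambda>n. 2 * (sin_trunc n (s / 2))\<^sup>2) \<longlonglongrightarrow> 2 * (s / 2)\<^sup>2"
    by (intro tendsto_intros sin_trunc_tendsto)
  then show ?thesis by (simp add: sin_trunc_prim_eq power_divide)
qed

lemma sin_trunc_deriv_tendsto: "(\<lambda>n. sin_trunc_deriv n s) \<longlonglongrightarrow> 1"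
proof -
  have "((\<lambda>h. cos (h * s)) \<longlongrightarrow> cos (0 * s)) (at 0)"
    by (intro tendsto_intros)
  from filterlim_compose[OF this filterlim_inverse_Suc] show ?thesis
    by (simp add: sin_trunc_deriv_def)
qed

lemma L2v_tendsto_sin_trunc:
  assumes u: "L2v \<Omega> u"
  shows "L2v_tendsto \<Omega> (\<lambda>n x. componentwise (sin_trunc n) (u x)) u"
  unfolding L2v_tendsto_iff_components
proof
  fix j :: 'a assume j: "j \<in> Basis"
  note u_j = L2v_component[OF u j]
  show "L2_tendsto \<Omega> (\<lambda>n x. componentwise (sin_trunc n) (u x) \<bullet> j) (\<lambda>x. u x \<bullet> j)"
    unfolding componentwise_inner[OF j]
    by (rule L2_tendsto_compose[where H = "\<lambda>s. s"])
       (simp_all add: u_j L2_measurable[OF u_j] abs_sin_trunc_le sin_trunc_tendsto)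
qed

lemma grad_tendsto_sin_trunc:
  assumes u: "H1 \<Omega> u Du"
  shows "grad_tendsto \<Omega> (\<lambda>n. componentwise_grad (sin_trunc_deriv n) u Du) Du"
  unfolding grad_tendsto_def L2v_tendsto_iff_components
proof (intro ballI)
  fix i j :: 'a assume i: "i \<in> Basis" and j: "j \<in> Basis"
  note Du = L2v_component[OF H1_grad_L2v[OF u i] j]
  note [measurable] = L2_measurable[OF Du] L2_measurable[OF L2v_component[OF H1_L2v[OF u] j]]
  show "L2_tendsto \<Omega> (\<lambda>n x. componentwise_grad (sin_trunc_deriv n) u Du x i \<bullet> j) (\<lambda>x. Du x i \<bullet> j)"
    unfolding componentwise_grad_inner[OF j]
  proof (rule L2_dominated_convergence[OF Du])
    show "\<bar>sin_trunc_deriv n (u x \<bullet> j) * (Du x i \<bullet> j)\<bar> \<le> \<bar>Du x i \<bullet> j\<bar>" for n x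
      by (simp add: abs_mult abs_sin_trunc_deriv_le mult_left_le_one_le)
    show "AE x in lebesgue_on \<Omega>. (\<lambda>n. sin_trunc_deriv n (u x \<bullet> j) * (Du x i \<bullet> j)) \<longlonglongrightarrow> Du x i \<bullet> j"
      using tendsto_mult_right[OF sin_trunc_deriv_tendsto] by (intro always_eventually) fastforce
  qed simp_all
qed

lemma L2_tendsto_inner_sin_trunc:
  assumes u: "L2v \<Omega> u" and square: "\<And>j. j \<in> Basis \<Longrightarrow> L2 \<Omega> (\<lambda>x. (u x \<bullet> j)\<^sup>2)"
  shows "L2_tendsto \<Omega> (\<lambda>n x. u x \<bullet> componentwise (sin_trunc n) (u x)) (\<lambda>x. (norm (u x))\<^sup>2)"
  unfolding inner_componentwise norm_square_components
proof (rule L2_tendsto_sum, rule L2_tendsto_compose[where H = "\<lambda>s. s\<^sup>2"])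
  show "\<bar>s * sin_trunc n s\<bar> \<le> \<bar>s\<^sup>2\<bar>" for n s
    unfolding power2_eq_square abs_mult by (intro mult_left_mono abs_sin_trunc_le) simp
  show "(\<lambda>n. s * sin_trunc n s) \<longlonglongrightarrow> s\<^sup>2" for s
    unfolding power2_eq_square by (intro tendsto_intros sin_trunc_tendsto)
qed (simp_all add: square L2_measurable[OF L2v_component[OF u]])

lemma L2_tendsto_sin_trunc_prim:
  assumes u: "L2v \<Omega> u" and square: "\<And>j. j \<in> Basis \<Longrightarrow> L2 \<Omega> (\<lambda>x. (u x \<bullet> j)\<^sup>2)"
  shows "L2_tendsto \<Omega> (\<lambda>n x. \<Sum>j\<in>Basis. sin_trunc_prim n (u x \<bullet> j)) (\<lambda>x. 1 / 2 * (norm (u x))\<^sup>2)"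
  unfolding norm_square_components sum_distrib_left
proof (rule L2_tendsto_sum, rule L2_tendsto_compose[where H = "\<lambda>s. 1 / 2 * s\<^sup>2"])
  fix j :: 'a assume j: "j \<in> Basis"
  show "(\<lambda>x. u x \<bullet> j) \<in> borel_measurable (lebesgue_on \<Omega>)"
    by (rule L2_measurable[OF L2v_component[OF u j]])
  show "L2 \<Omega> (\<lambda>x. 1 / 2 * (u x \<bullet> j)\<^sup>2)"
    by (rule L2_cmult[OF square[OF j]])
qed (rule sin_trunc_measurable abs_sin_trunc_prim_le sin_trunc_prim_tendsto)+

section \<open>Testing the momentum equation with the solution\<close>

definition weak_momentum ::
  "'a::euclidean_space set \<Rightarrow> real \<Rightarrow> ('a \<Rightarrow> 'a) \<Rightarrow> ('a \<Rightarrow> 'a) \<Rightarrow> ('a \<Rightarrow> 'a \<Rightarrow> 'a) \<Rightarrow>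
    ('a \<Rightarrow> 'a) \<Rightarrow> ('a \<Rightarrow> 'a \<Rightarrow> 'a) \<Rightarrow> ('a \<Rightarrow> real) \<Rightarrow> (('a \<Rightarrow> 'a) \<Rightarrow> real) \<Rightarrow> bool" where
  "weak_momentum \<Omega> \<nu> a w Dw u Du p F \<longleftrightarrow> (\<forall>v Dv. H10 \<Omega> v Dv \<longrightarrow>
     (LINT x|lebesgue_on \<Omega>. a x \<bullet> v x + convect w Du x \<bullet> v x + (1/2) * divg Dw x * (u x \<bullet> v x)
       - p x * divg Dv x + \<nu> * grad_inner Du Dv x) = F v)"

definition weak_min_continuity ::
  "'a::euclidean_space set \<Rightarrow> real \<Rightarrow> real \<Rightarrow> real \<Rightarrow> ('a \<Rightarrow> real) \<Rightarrow> ('a \<Rightarrow> real) \<Rightarrow> ('a \<Rightarrow> 'a \<Rightarrow> 'a) \<Rightarrow> bool" where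
  "weak_min_continuity \<Omega> k \<epsilon>' \<epsilon> p' p Du \<longleftrightarrow> (\<forall>q. L2 \<Omega> q \<longrightarrow>
     (LINT x|lebesgue_on \<Omega>. ((\<epsilon>' * p' x - min \<epsilon>' \<epsilon> * p x) / k + divg Du x) * q x) = 0)"

lemma inner_componentwise_L2:
  assumes u: "L2v \<Omega> u" and [measurable]: "T \<in> borel_measurable borel" and B: "\<And>s. \<bar>T s\<bar> \<le> B"
  shows "L2 \<Omega> (\<lambda>x. u x \<bullet> componentwise T (u x))"
  unfolding inner_componentwise
proof (rule L2_sum)
  fix j :: 'a assume "j \<in> Basis"
  note L2 = L2v_component[OF u this]
  have "L2 \<Omega> (\<lambda>x. T (u x \<bullet> j) * (u x \<bullet> j))"
    using L2_measurable[OF L2] B by (intro L2_bounded_mult[OF L2]) simp_all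
  then show "L2 \<Omega> (\<lambda>x. (u x \<bullet> j) * T (u x \<bullet> j))" by (simp add: mult.commute)
qed

lemma grad_inner_tendsto:
  assumes u: "H1 \<Omega> u Du" and v: "\<And>n. H1 \<Omega> (v n) (Dv n)" and lim: "grad_tendsto \<Omega> Dv Du"
  shows "(\<lambda>n. LINT x|lebesgue_on \<Omega>. grad_inner Du (Dv n) x) \<longlonglongrightarrow> (LINT x|lebesgue_on \<Omega>. grad_sq Du x)"
proof -
  have "(\<lambda>n. LINT x|lebesgue_on \<Omega>. Du x i \<bullet> Dv n x i) \<longlonglongrightarrow> (LINT x|lebesgue_on \<Omega>. Du x i \<bullet> Du x i)"
    if i: "i \<in> Basis" for i
  proof -
    have "L2v_tendsto \<Omega> (\<lambda>n x. Dv n x i) (\<lambda>x. Du x i)"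
      using lim i by (simp add: grad_tendsto_def)
    from L2v_tendsto_integral_inner[OF this H1_grad_L2v[OF u i]] show ?thesis
      by (simp add: inner_commute)
  qed
  then show ?thesis
    unfolding grad_inner_integral[OF u v] grad_inner_self[symmetric] grad_inner_integral[OF u u]
    by (intro tendsto_sum)
qed

context lebesgue_domain
begin

lemma Hm1_tendsto:
  assumes F: "Hm1 \<Omega> F" and v: "\<And>n. H10 \<Omega> (v n) (Dv n)" and u: "H10 \<Omega> u Du"
    and lim: "grad_tendsto \<Omega> Dv Du"
  shows "(\<lambda>n. F (v n)) \<longlonglongrightarrow> F u"
proof -
  obtain C where C: "\<And>v Dv. H10 \<Omega> v Dv \<Longrightarrow> \<bar>F v\<bar> \<le> C * grad_norm \<Omega> Dv"
    using F unfolding Hm1_def by blast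
  let ?d = "\<lambda>n x. 1 *\<^sub>R v n x + (- 1) *\<^sub>R u x" and ?Dd = "\<lambda>n x i. 1 *\<^sub>R Dv n x i + (- 1) *\<^sub>R Du x i"
  have diff: "F (v n) - F u = F (?d n)" for n
  proof -
    have "F (?d n) = 1 * F (v n) + (- 1) * F u"
      using F v[of n] u unfolding Hm1_def by blast
    then show ?thesis by simp
  qed
  have "(\<lambda>n. LINT x|lebesgue_on \<Omega>. grad_sq (?Dd n) x) \<longlonglongrightarrow> 0"
    using lim H1_grad_L2v[OF H10_imp_H1[OF v]] H1_grad_L2v[OF H10_imp_H1[OF u]]
    by (subst (asm) grad_tendsto_iff) (simp_all add: grad_sq_def)
  then have "(\<lambda>n. C * grad_norm \<Omega> (?Dd n)) \<longlonglongrightarrow> C * sqrt 0"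
    unfolding grad_norm_def by (intro tendsto_intros)
  then have bound_tendsto: "(\<lambda>n. C * grad_norm \<Omega> (?Dd n)) \<longlonglongrightarrow> 0" by simp
  have "\<forall>n. norm (F (v n) - F u) \<le> C * grad_norm \<Omega> (?Dd n)"
    unfolding diff real_norm_def by (intro allI C H10_lincomb v u)
  then show ?thesis
    by (rule LIM_zero_cancel[OF Lim_null_comparison[OF always_eventually bound_tendsto]])
qed

lemma
  assumes w: "H1 \<Omega> w Dw" and u: "H10 \<Omega> u Du"
  shows convect_sin_trunc_integrable:
      "integrable (lebesgue_on \<Omega>) (\<lambda>x. convect w Du x \<bullet> componentwise (sin_trunc n) (u x))"
    and convect_sin_trunc_integral:
      "(LINT x|lebesgue_on \<Omega>. convect w Du x \<bullet> componentwise (sin_trunc n) (u x))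
        = - (LINT x|lebesgue_on \<Omega>. (\<Sum>j\<in>Basis. sin_trunc_prim n (u x \<bullet> j)) * divg Dw x)"
  by (rule convect_componentwise_integrable convect_componentwise_integral;
      rule smooth_fun_sin_trunc_prim sin_trunc_prim_zero sin_trunc_prim_has_derivative
        abs_sin_trunc_bounded w u)+

lemma skew_convection_sin_trunc_tendsto:
  assumes dim: "DIM('a) = 2 \<or> DIM('a) = 3" and w: "H1 \<Omega> w Dw" and u: "H10 \<Omega> u Du"
  shows "(\<lambda>n. (LINT x|lebesgue_on \<Omega>. convect w Du x \<bullet> componentwise (sin_trunc n) (u x))
    + (LINT x|lebesgue_on \<Omega>. (1/2) * divg Dw x * (u x \<bullet> componentwise (sin_trunc n) (u x)))) \<longlonglongrightarrow> 0"
proof -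
  let ?M = "lebesgue_on \<Omega>"
  note u_L2 = H1_L2v[OF H10_imp_H1[OF u]] and u_L4 = H10_Ladyzhenskaya[OF dim u]
  have "(LINT x|?M. (1/2) * divg Dw x * (u x \<bullet> componentwise (sin_trunc n) (u x)))
      = 1/2 * (LINT x|?M. (u x \<bullet> componentwise (sin_trunc n) (u x)) * divg Dw x)" for n
    by (simp add: mult_ac flip: integral_mult_right_zero)
  moreover have "(\<lambda>n. - (LINT x|?M. (\<Sum>j\<in>Basis. sin_trunc_prim n (u x \<bullet> j)) * divg Dw x)
      + 1/2 * (LINT x|?M. (u x \<bullet> componentwise (sin_trunc n) (u x)) * divg Dw x))
    \<longlonglongrightarrow> - (LINT x|?M. 1/2 * (norm (u x))\<^sup>2 * divg Dw x) + 1/2 * (LINT x|?M. (norm (u x))\<^sup>2 * divg Dw x)"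
    by (intro tendsto_intros L2_tendsto_integral_mult L2_tendsto_sin_trunc_prim
        L2_tendsto_inner_sin_trunc u_L2 u_L4 divg_L2[OF w])
  ultimately show ?thesis
    by (simp add: convect_sin_trunc_integral[OF w u] mult.assoc)
qed

lemma weak_momentum_split:
  assumes momentum: "weak_momentum \<Omega> \<nu> a w Dw u Du p F" and v: "H10 \<Omega> v Dv"
    and w: "H1 \<Omega> w Dw" and u: "H1 \<Omega> u Du" and a: "L2v \<Omega> a" and p: "L2 \<Omega> p"
    and convection: "integrable (lebesgue_on \<Omega>) (\<lambda>x. convect w Du x \<bullet> v x)" and uv: "L2 \<Omega> (\<lambda>x. u x \<bullet> v x)"
  shows "F v = (LINT x|lebesgue_on \<Omega>. v x \<bullet> a x)
    + ((LINT x|lebesgue_on \<Omega>. convect w Du x \<bullet> v x) + (LINT x|lebesgue_on \<Omega>. (1/2) * divg Dw x * (u x \<bullet> v x)))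
    - (LINT x|lebesgue_on \<Omega>. divg Dv x * p x) + \<nu> * (LINT x|lebesgue_on \<Omega>. grad_inner Du Dv x)"
proof -
  have "integrable (lebesgue_on \<Omega>) (\<lambda>x. (1/2) * divg Dw x * (u x \<bullet> v x))"
    by (intro L2_mult_integrable L2_cmult divg_L2[OF w] uv)
  moreover have "integrable (lebesgue_on \<Omega>) (\<lambda>x. a x \<bullet> v x)"
    by (rule L2v_inner_integrable[OF a H1_L2v[OF H10_imp_H1[OF v]]])
  moreover have "integrable (lebesgue_on \<Omega>) (\<lambda>x. p x * divg Dv x)"
    by (rule L2_mult_integrable[OF p divg_L2[OF H10_imp_H1[OF v]]])
  moreover note grad_inner_integrable[OF u H10_imp_H1[OF v]] convection
    and momentum[unfolded weak_momentum_def, rule_format, OF v, symmetric]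
  ultimately show ?thesis
    by (simp add: inner_commute[of "a _"] mult.commute[of _ "p _"]
        del: integral_mult_right_zero integrable_mult_left_iff)
qed

lemma H10_energy_identity:
  assumes dim: "DIM('a) = 2 \<or> DIM('a) = 3"
    and w: "H1 \<Omega> w Dw" and u: "H10 \<Omega> u Du" and a: "L2v \<Omega> a" and p: "L2 \<Omega> p" and F: "Hm1 \<Omega> F"
    and momentum: "weak_momentum \<Omega> \<nu> a w Dw u Du p F"
  shows "F u = (LINT x|lebesgue_on \<Omega>. a x \<bullet> u x) - (LINT x|lebesgue_on \<Omega>. p x * divg Du x)
    + \<nu> * (LINT x|lebesgue_on \<Omega>. grad_sq Du x)"
proof -
  let ?M = "lebesgue_on \<Omega>"
  define v where "v n x = componentwise (sin_trunc n) (u x)" for n x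
  define Dv where "Dv n = componentwise_grad (sin_trunc_deriv n) u Du" for n
  note uH1 = H10_imp_H1[OF u]
  have v: "H10 \<Omega> (v n) (Dv n)" for n
    unfolding v_def[abs_def] Dv_def
    by (rule H10_componentwise[OF smooth_fun_sin_trunc sin_trunc_zero sin_trunc_has_derivative
          abs_sin_trunc_deriv_le u])
  have v_tendsto: "L2v_tendsto \<Omega> v u" and Dv_tendsto: "grad_tendsto \<Omega> Dv Du"
    unfolding v_def[abs_def] Dv_def[abs_def]
    by (intro L2v_tendsto_sin_trunc grad_tendsto_sin_trunc H1_L2v[OF uH1] uH1)+
  have "L2 \<Omega> (\<lambda>x. u x \<bullet> v n x)" for n
    unfolding v_def by (rule inner_componentwise_L2[OF H1_L2v[OF uH1] _ abs_sin_trunc_bounded]) simp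
  then have "F (v n) = (LINT x|?M. v n x \<bullet> a x)
      + ((LINT x|?M. convect w Du x \<bullet> v n x) + (LINT x|?M. (1/2) * divg Dw x * (u x \<bullet> v n x)))
      - (LINT x|?M. divg (Dv n) x * p x) + \<nu> * (LINT x|?M. grad_inner Du (Dv n) x)" for n
    using convect_sin_trunc_integrable[OF w u]
    by (intro weak_momentum_split[OF momentum v w uH1 a p]) (simp_all add: v_def)
  moreover have "(\<lambda>n. (LINT x|?M. v n x \<bullet> a x)
      + ((LINT x|?M. convect w Du x \<bullet> v n x) + (LINT x|?M. (1/2) * divg Dw x * (u x \<bullet> v n x)))
      - (LINT x|?M. divg (Dv n) x * p x) + \<nu> * (LINT x|?M. grad_inner Du (Dv n) x))
    \<longlonglongrightarrow> (LINT x|?M. u x \<bullet> a x) + 0 - (LINT x|?M. divg Du x * p x) + \<nu> * (LINT x|?M. grad_sq Du x)"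
    using skew_convection_sin_trunc_tendsto[OF dim w u, folded v_def]
    by (intro tendsto_intros L2v_tendsto_integral_inner v_tendsto a L2_tendsto_integral_mult
        L2_tendsto_divg Dv_tendsto p grad_inner_tendsto[OF uH1 H10_imp_H1[OF v]])
  ultimately show ?thesis
    using LIMSEQ_unique[OF Hm1_tendsto[OF F v u Dv_tendsto]] by (simp add: inner_commute mult.commute)
qed

end

section \<open>The discrete energy balance\<close>

definition kinetic_pressure_energy ::
  "'a::euclidean_space set \<Rightarrow> real \<Rightarrow> ('a \<Rightarrow> 'a) \<Rightarrow> ('a \<Rightarrow> real) \<Rightarrow> real" where
  "kinetic_pressure_energy \<Omega> \<epsilon> u p = (1/2) * (LINT x|lebesgue_on \<Omega>. (norm (u x))\<^sup>2 + \<epsilon> * (p x)\<^sup>2)"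

definition pressure_dissipation ::
  "'a::euclidean_space set \<Rightarrow> real \<Rightarrow> real \<Rightarrow> ('a \<Rightarrow> real) \<Rightarrow> ('a \<Rightarrow> real) \<Rightarrow> real" where
  "pressure_dissipation \<Omega> \<epsilon>' \<epsilon> p' p = (1/2) * (LINT x|lebesgue_on \<Omega>. min \<epsilon>' \<epsilon> * (p' x - p x)\<^sup>2
     + pos_part (\<epsilon>' - \<epsilon>) * (p' x)\<^sup>2 + pos_part (\<epsilon> - \<epsilon>') * (p x)\<^sup>2)"

lemma polarization_increment:
  fixes u u' :: "'a::real_inner"
  shows "(u' - u) \<bullet> u' = 1/2 * ((norm u')\<^sup>2 - (norm u)\<^sup>2 + (norm (u' - u))\<^sup>2)"
  by (simp add: power2_norm_eq_inner inner_diff_left inner_diff_right inner_commute)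

lemma min_weighted_polarization:
  fixes \<epsilon> \<epsilon>' p p' :: real
  shows "(\<epsilon>' * p' - min \<epsilon>' \<epsilon> * p) * p' = 1/2 * (\<epsilon>' * p'\<^sup>2 - \<epsilon> * p\<^sup>2
    + (min \<epsilon>' \<epsilon> * (p' - p)\<^sup>2 + pos_part (\<epsilon>' - \<epsilon>) * p'\<^sup>2 + pos_part (\<epsilon> - \<epsilon>') * p\<^sup>2))"
  by (cases "\<epsilon> \<le> \<epsilon>'")
     (simp_all add: pos_part_def min_def max_def power2_eq_square algebra_simps)

lemma integral_velocity_increment:
  assumes "L2v \<Omega> u" "L2v \<Omega> u'" "k > 0"
  shows "k * (LINT x|lebesgue_on \<Omega>. ((1/k) *\<^sub>R (u' x - u x)) \<bullet> u' x)
    = 1/2 * ((LINT x|lebesgue_on \<Omega>. (norm (u' x))\<^sup>2) - (LINT x|lebesgue_on \<Omega>. (norm (u x))\<^sup>2)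
      + (LINT x|lebesgue_on \<Omega>. (norm (u' x - u x))\<^sup>2))"
  using assms L2v_diff[OF assms(2,1)]
  by (simp add: polarization_increment L2v_norm_square_integrable)

lemma integral_pressure_increment:
  assumes p: "L2 \<Omega> p" and p': "L2 \<Omega> p'" and d: "L2 \<Omega> (divg Du)" and k: "k > 0"
    and continuity: "weak_min_continuity \<Omega> k \<epsilon>' \<epsilon> p' p Du"
  shows "k * (LINT x|lebesgue_on \<Omega>. p' x * divg Du x)
    = - (1/2 * (\<epsilon>' * (LINT x|lebesgue_on \<Omega>. (p' x)\<^sup>2) - \<epsilon> * (LINT x|lebesgue_on \<Omega>. (p x)\<^sup>2))
      + pressure_dissipation \<Omega> \<epsilon>' \<epsilon> p' p)"
proof -
  let ?M = "lebesgue_on \<Omega>" and ?q = "\<lambda>x. \<epsilon>' * p' x - min \<epsilon>' \<epsilon> * p x"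
  have "L2 \<Omega> ?q" by (intro L2_diff L2_cmult p p')
  then have "(LINT x|?M. (?q x / k + divg Du x) * p' x)
      = (LINT x|?M. ?q x * p' x) / k + (LINT x|?M. p' x * divg Du x)"
    using L2_mult_integrable[of \<Omega> ?q p'] L2_mult_integrable[OF p' d] p'
    by (simp add: distrib_right mult.commute[of "divg Du _"])
  moreover have "(LINT x|?M. (?q x / k + divg Du x) * p' x) = 0"
    using continuity p' by (simp add: weak_min_continuity_def)
  ultimately have "k * (LINT x|?M. p' x * divg Du x) = - (LINT x|?M. ?q x * p' x)"
    using k by (simp add: field_simps)
  also have "(LINT x|?M. ?q x * p' x) = 1/2 * (\<epsilon>' * (LINT x|?M. (p' x)\<^sup>2) - \<epsilon> * (LINT x|?M. (p x)\<^sup>2))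
      + pressure_dissipation \<Omega> \<epsilon>' \<epsilon> p' p"
    unfolding min_weighted_polarization pressure_dissipation_def
    using p p' L2_square_integrable[OF L2_diff[OF p' p]]
    by (simp add: L2_square_integrable distrib_left)
  finally show ?thesis .
qed

lemma grad_norm_nonneg: "grad_norm \<Omega> Du \<ge> 0"
  by (simp add: grad_norm_def grad_sq_def integral_nonneg_AE sum_nonneg)

lemma grad_norm_power2: "(grad_norm \<Omega> Du)\<^sup>2 = (LINT x|lebesgue_on \<Omega>. grad_sq Du x)"
  by (simp add: grad_norm_def grad_sq_def integral_nonneg_AE sum_nonneg)

lemma Hm1_le_dual_norm:
  assumes F: "Hm1 \<Omega> F" and u: "H10 \<Omega> u Du"
  shows "\<bar>F u\<bar> \<le> dual_norm \<Omega> F * grad_norm \<Omega> Du"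
proof -
  obtain C where C: "\<And>v Dv. H10 \<Omega> v Dv \<Longrightarrow> \<bar>F v\<bar> \<le> C * grad_norm \<Omega> Dv"
    using F unfolding Hm1_def by blast
  show ?thesis
  proof (cases "grad_norm \<Omega> Du = 0")
    case True
    then show ?thesis using C[OF u] by simp
  next
    case False
    have "\<bar>F v\<bar> / grad_norm \<Omega> Dv \<le> \<bar>C\<bar>" if "H10 \<Omega> v Dv" for v Dv
    proof -
      have "\<bar>F v\<bar> \<le> \<bar>C\<bar> * grad_norm \<Omega> Dv"
        by (rule order_trans[OF C[OF that] mult_right_mono[OF abs_ge_self grad_norm_nonneg]])
      then show ?thesis
        using grad_norm_nonneg[of \<Omega> Dv] by (cases "grad_norm \<Omega> Dv = 0") (simp_all add: divide_le_eq)
    qed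
    then have "bdd_above {\<bar>F v\<bar> / grad_norm \<Omega> Dv | v Dv. H10 \<Omega> v Dv}"
      by (intro bdd_aboveI) auto
    then have "\<bar>F u\<bar> / grad_norm \<Omega> Du \<le> dual_norm \<Omega> F"
      unfolding dual_norm_def using u by (intro cSup_upper) auto
    then show ?thesis
      using False grad_norm_nonneg[of \<Omega> Du] by (simp add: divide_le_eq)
  qed
qed

lemma Hm1_le_Young:
  assumes F: "Hm1 \<Omega> F" and u: "H10 \<Omega> u Du" and \<nu>: "\<nu> > 0"
  shows "F u \<le> 1 / (2 * \<nu>) * (dual_norm \<Omega> F)\<^sup>2 + 1/2 * (\<nu> * (LINT x|lebesgue_on \<Omega>. grad_sq Du x))"
proof -
  let ?f = "dual_norm \<Omega> F" and ?g = "grad_norm \<Omega> Du"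
  have "F u \<le> ?f * ?g"
    using Hm1_le_dual_norm[OF F u] by linarith
  also have "\<dots> = 1 / (2 * \<nu>) * ?f\<^sup>2 + 1/2 * (\<nu> * ?g\<^sup>2) - (?f - \<nu> * ?g)\<^sup>2 / (2 * \<nu>)"
    using \<nu> by (simp add: power2_eq_square field_simps)
  also have "\<dots> \<le> 1 / (2 * \<nu>) * ?f\<^sup>2 + 1/2 * (\<nu> * ?g\<^sup>2)"
    using \<nu> by simp
  finally show ?thesis unfolding grad_norm_power2 .
qed

lemma forcing_absorbed_by_dissipation:
  assumes F: "Hm1 \<Omega> F" and u: "H10 \<Omega> u Du" and w: "L2v \<Omega> w" and \<nu>: "\<nu> > 0" and k: "k > 0"
  shows "k * F u - (LINT x|lebesgue_on \<Omega>. (1/2) * (norm (w x))\<^sup>2 + k * \<nu> * grad_sq Du x)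
    \<le> k * (1 / (2 * \<nu>)) * (dual_norm \<Omega> F)\<^sup>2
      - (1/2) * (LINT x|lebesgue_on \<Omega>. (norm (w x))\<^sup>2 + k * \<nu> * grad_sq Du x)"
proof -
  have "k * F u \<le> k * (1 / (2 * \<nu>) * (dual_norm \<Omega> F)\<^sup>2 + 1/2 * (\<nu> * (LINT x|lebesgue_on \<Omega>. grad_sq Du x)))"
    using Hm1_le_Young[OF F u \<nu>] k by (intro mult_left_mono) simp_all
  then show ?thesis
    using L2v_norm_square_integrable[OF w] grad_sq_integrable[OF H10_imp_H1[OF u]]
    by (simp add: algebra_simps)
qed

context lebesgue_domain
begin

context
  fixes k \<nu> \<epsilon> \<epsilon>' w Dw u u' Du' p p' F
  assumes dim: "DIM('a) = 2 \<or> DIM('a) = 3" and k: "k > 0" and w: "H1 \<Omega> w Dw" and u: "L2v \<Omega> u"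
    and u': "H10 \<Omega> u' Du'" and p: "L2 \<Omega> p" and p': "L2 \<Omega> p'" and F: "Hm1 \<Omega> F"
    and momentum: "weak_momentum \<Omega> \<nu> (\<lambda>x. (1/k) *\<^sub>R (u' x - u x)) w Dw u' Du' p' F"
    and continuity: "weak_min_continuity \<Omega> k \<epsilon>' \<epsilon> p' p Du'"
begin

lemma min_method_energy_step:
  "kinetic_pressure_energy \<Omega> \<epsilon>' u' p' + pressure_dissipation \<Omega> \<epsilon>' \<epsilon> p' p
      + (LINT x|lebesgue_on \<Omega>. (1/2) * (norm (u' x - u x))\<^sup>2 + k * \<nu> * grad_sq Du' x)
    = kinetic_pressure_energy \<Omega> \<epsilon> u p + k * F u'"
proof -
  let ?M = "lebesgue_on \<Omega>"
  note u'H1 = H10_imp_H1[OF u'] note u'L2 = H1_L2v[OF u'H1]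
  have "L2v \<Omega> (\<lambda>x. (1/k) *\<^sub>R (u' x - u x))"
    using L2v_lincomb[OF u'L2 u, of "1/k" "- (1/k)"] by (simp add: scaleR_diff_right)
  note momentum_balance = H10_energy_identity[OF dim w u' this p' F momentum]
  have "k * F u' = k * (LINT x|?M. ((1/k) *\<^sub>R (u' x - u x)) \<bullet> u' x) - k * (LINT x|?M. p' x * divg Du' x)
      + k * \<nu> * (LINT x|?M. grad_sq Du' x)"
    by (simp only: momentum_balance distrib_left right_diff_distrib mult.assoc)
  moreover note integral_velocity_increment[OF u u'L2 k]
    and integral_pressure_increment[OF p p' divg_L2[OF u'H1] k continuity]
  moreover have "kinetic_pressure_energy \<Omega> \<epsilon> v q
      = 1/2 * ((LINT x|?M. (norm (v x))\<^sup>2) + \<epsilon> * (LINT x|?M. (q x)\<^sup>2))" if "L2v \<Omega> v" "L2 \<Omega> q" for \<epsilon> v q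
    using that by (simp add: kinetic_pressure_energy_def L2v_norm_square_integrable L2_square_integrable)
  moreover have "(LINT x|?M. (1/2) * (norm (u' x - u x))\<^sup>2 + k * \<nu> * grad_sq Du' x)
      = 1/2 * (LINT x|?M. (norm (u' x - u x))\<^sup>2) + k * \<nu> * (LINT x|?M. grad_sq Du' x)"
    using L2v_norm_square_integrable[OF L2v_diff[OF u'L2 u]] grad_sq_integrable[OF u'H1] by simp
  ultimately show ?thesis
    using u u'L2 p p' by (simp add: algebra_simps)
qed

lemma min_method_stability_step:
  assumes "\<nu> > 0"
  shows "kinetic_pressure_energy \<Omega> \<epsilon>' u' p' + pressure_dissipation \<Omega> \<epsilon>' \<epsilon> p' p
      + (1/2) * (LINT x|lebesgue_on \<Omega>. (norm (u' x - u x))\<^sup>2 + k * \<nu> * grad_sq Du' x)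
    \<le> kinetic_pressure_energy \<Omega> \<epsilon> u p + k * (1 / (2 * \<nu>)) * (dual_norm \<Omega> F)\<^sup>2"
  using min_method_energy_step
    forcing_absorbed_by_dissipation[OF F u' L2v_diff[OF H1_L2v[OF H10_imp_H1[OF u']] u] \<open>\<nu> > 0\<close> k]
  by linarith

end

end

lemma telescoping_balance:
  fixes E P D f :: "nat \<Rightarrow> real"
  assumes "\<And>n. E (Suc n) + P n + D n = E n + f n"
  shows "E N + (\<Sum>n<N. P n) + (\<Sum>n<N. D n) = E 0 + (\<Sum>n<N. f n)"
proof (induction N)
  case (Suc N)
  then show ?case using assms[of N] by simp
qed simp

lemma telescoping_bound:
  fixes E P D f :: "nat \<Rightarrow> real"
  assumes "\<And>n. E (Suc n) + P n + D n \<le> E n + f n"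
  shows "E N + (\<Sum>n<N. P n) + (\<Sum>n<N. D n) \<le> E 0 + (\<Sum>n<N. f n)"
proof (induction N)
  case (Suc N)
  then show ?case using assms[of N] by simp
qed simp

theorem theorem2p1:
  fixes \<Omega> :: "'a::euclidean_space set"
    and \<nu> :: real
    and k \<epsilon> :: "nat \<Rightarrow> real"
    and F :: "nat \<Rightarrow> ('a \<Rightarrow> 'a) \<Rightarrow> real"
    and u :: "nat \<Rightarrow> 'a \<Rightarrow> 'a" and Du :: "nat \<Rightarrow> 'a \<Rightarrow> 'a \<Rightarrow> 'a"
    and um1 :: "'a \<Rightarrow> 'a" and Dum1 :: "'a \<Rightarrow> 'a \<Rightarrow> 'a"
    and p :: "nat \<Rightarrow> 'a \<Rightarrow> real"
    and N :: nat
  assumes dim: "DIM('a) = 2 \<or> DIM('a) = 3"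
    and dom: "lipschitz_domain \<Omega>"
    and nu: "\<nu> > 0"
    and kpos: "\<forall>n. k n > 0"
    and epos: "\<forall>n. \<epsilon> n > 0"
    and forcing: "\<forall>n. Hm1 \<Omega> (F (Suc n))"
    and init_u: "H1 \<Omega> (u 0) (Du 0)" "H1 \<Omega> um1 Dum1"
    and init_p: "L2 \<Omega> (p 0)"
    and reg_u: "\<forall>n. H10 \<Omega> (u (Suc n)) (Du (Suc n))"
    and reg_p: "\<forall>n. L2 \<Omega> (p (Suc n))"
    and momentum: "\<forall>n. let r = k (Suc n) / k n;
                        us = (\<lambda>x. (1 + r) *\<^sub>R u n x - r *\<^sub>R prev um1 u n x);
                        Dus = (\<lambda>x i. (1 + r) *\<^sub>R Du n x i - r *\<^sub>R prev Dum1 Du n x i)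
                    in \<forall>v Dv. H10 \<Omega> v Dv \<longrightarrow>
                       (LINT x|lebesgue_on \<Omega>.
                           ((1 / k (Suc n)) *\<^sub>R (u (Suc n) x - u n x)) \<bullet> v x
                         + convect us (Du (Suc n)) x \<bullet> v x
                         + (1/2) * divg Dus x * (u (Suc n) x \<bullet> v x)
                         - p (Suc n) x * divg Dv x
                         + \<nu> * grad_inner (Du (Suc n)) Dv x)
                       = F (Suc n) v"
    and continuity: "\<forall>n q. L2 \<Omega> q \<longrightarrow>
                       (LINT x|lebesgue_on \<Omega>.
                          ((\<epsilon> (Suc n) * p (Suc n) x - min (\<epsilon> (Suc n)) (\<epsilon> n) * p n x) / k (Suc n)
                           + divg (Du (Suc n)) x) * q x) = 0"
    and N: "N > 0"
  shows "(1/2) * (LINT x|lebesgue_on \<Omega>. (norm (u N x))\<^sup>2 + \<epsilon> N * (p N x)\<^sup>2)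
         + (\<Sum>n<N. (1/2) * (LINT x|lebesgue_on \<Omega>.
              min (\<epsilon> (Suc n)) (\<epsilon> n) * (p (Suc n) x - p n x)\<^sup>2
              + pos_part (\<epsilon> (Suc n) - \<epsilon> n) * (p (Suc n) x)\<^sup>2
              + pos_part (\<epsilon> n - \<epsilon> (Suc n)) * (p n x)\<^sup>2))
         + (\<Sum>n<N. (LINT x|lebesgue_on \<Omega>.
              (1/2) * (norm (u (Suc n) x - u n x))\<^sup>2 + k (Suc n) * \<nu> * grad_sq (Du (Suc n)) x))
       = (1/2) * (LINT x|lebesgue_on \<Omega>. (norm (u 0 x))\<^sup>2 + \<epsilon> 0 * (p 0 x)\<^sup>2)
         + (\<Sum>n<N. k (Suc n) * F (Suc n) (u (Suc n)))
     \<and> (1/2) * (LINT x|lebesgue_on \<Omega>. (norm (u N x))\<^sup>2 + \<epsilon> N * (p N x)\<^sup>2)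
         + (\<Sum>n<N. (1/2) * (LINT x|lebesgue_on \<Omega>.
              min (\<epsilon> (Suc n)) (\<epsilon> n) * (p (Suc n) x - p n x)\<^sup>2
              + pos_part (\<epsilon> (Suc n) - \<epsilon> n) * (p (Suc n) x)\<^sup>2
              + pos_part (\<epsilon> n - \<epsilon> (Suc n)) * (p n x)\<^sup>2))
         + (\<Sum>n<N. (1/2) * (LINT x|lebesgue_on \<Omega>.
              (norm (u (Suc n) x - u n x))\<^sup>2 + k (Suc n) * \<nu> * grad_sq (Du (Suc n)) x))
       \<le> (1/2) * (LINT x|lebesgue_on \<Omega>. (norm (u 0 x))\<^sup>2 + \<epsilon> 0 * (p 0 x)\<^sup>2)
         + (\<Sum>n<N. k (Suc n) * (1 / (2 * \<nu>)) * (dual_norm \<Omega> (F (Suc n)))\<^sup>2)"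
proof -
  interpret lebesgue_domain \<Omega>
    using dom by unfold_locales (simp add: lipschitz_domain_def lmeasurable_open fmeasurableD)
  have u: "H1 \<Omega> (u n) (Du n)" for n
    using init_u(1) reg_u by (cases n) (auto intro: H10_imp_H1)
  then have prev_u: "H1 \<Omega> (prev um1 u n) (prev Dum1 Du n)" for n
    using init_u(2) by (simp add: prev_def)
  have p: "L2 \<Omega> (p n)" for n
    using init_p reg_p by (cases n) auto
  have u_star: "H1 \<Omega> (\<lambda>x. (1 + r) *\<^sub>R u n x - r *\<^sub>R prev um1 u n x)
      (\<lambda>x i. (1 + r) *\<^sub>R Du n x i - r *\<^sub>R prev Dum1 Du n x i)" for r n
    using H1_lincomb[OF u prev_u, of "1 + r" n "- r" n] by simp
  have weak_momentum_n: "weak_momentum \<Omega> \<nu> (\<lambda>x. (1 / k (Suc n)) *\<^sub>R (u (Suc n) x - u n x))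
      (\<lambda>x. (1 + k (Suc n) / k n) *\<^sub>R u n x - (k (Suc n) / k n) *\<^sub>R prev um1 u n x)
      (\<lambda>x i. (1 + k (Suc n) / k n) *\<^sub>R Du n x i - (k (Suc n) / k n) *\<^sub>R prev Dum1 Du n x i)
      (u (Suc n)) (Du (Suc n)) (p (Suc n)) (F (Suc n))" for n
    using momentum by (simp add: weak_momentum_def Let_def)
  have weak_continuity_n: "weak_min_continuity \<Omega> (k (Suc n)) (\<epsilon> (Suc n)) (\<epsilon> n)
      (p (Suc n)) (p n) (Du (Suc n))" for n
    using continuity by (simp add: weak_min_continuity_def)
  note step = dim spec[OF kpos] u_star H1_L2v[OF u] spec[OF reg_u] p p spec[OF forcing]
    weak_momentum_n weak_continuity_n
  let ?E = "\<lambda>n. kinetic_pressure_energy \<Omega> (\<epsilon> n) (u n) (p n)"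
  show ?thesis
    using telescoping_balance[where E = ?E and N = N, OF min_method_energy_step[OF step]]
      telescoping_bound[where E = ?E and N = N, OF min_method_stability_step[OF step nu]]
    unfolding kinetic_pressure_energy_def pressure_dissipation_def by simp
qed

end
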